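(* Let $P$ be a finite naturally labeled poset whose shape $\operatorname{sh}(P)$ is hook shaped. If $Q$ is a finite naturally labeled poset with $\operatorname{supp}_L(K_P(\mathbf{x}))=\operatorname{supp}_L(K_Q(\mathbf{x}))$, then $P\cong Q$.
   Context: A poset $(P,\preceq)$ on ground set $[n]=\{1,\dots,n\}$ is naturally labeled if $x\preceq y$ implies $x\le y$ as integers. For such $P$, the $P$-partition generating function is $K_P(\mathbf{x})=\sum_{\sigma}\prod_{p\in P}x_{\sigma(p)}$, the sum over all maps $\sigma:P\to\mathbb{Z}^+$ with $\sigma(x)\le\sigma(y)$ whenever $x\preceq y$; it is a quasisymmetric function. For a composition $\alpha=(\alpha_1,\dots,\alpha_k)$ of $n$ let $D(\alpha)=\{\alpha_1,\alpha_1+\alpha_2,\dots,\alpha_1+\cdots+\alpha_{k-1}\}$, and let $L_\alpha=\sum x_{i_1}\cdots x_{i_n}$, summed over $i_1\le\cdots\le i_n$ with $i_s<i_{s+1}$ whenever $s\in D(\alpha)$. The $L_\alpha$ form a basis of quasisymmetric functions, and $\operatorname{supp}_L(K_P(\mathbf{x}))$ is the set of compositions $\alpha$ whose coefficient in the expansion of $K_P(\mathbf{x})$ in this basis is nonzero. The shape $\operatorname{sh}(P)$ is the partition $\lambda$ whose conjugate $\lambda'$ satisfies $\lambda'_1+\cdots+\lambda'_i=a_i$ for all $i$, where $a_i$ is the maximum number of elements in a union of $i$ antichains of $P$. A partition $\lambda$ is hook shaped if $\lambda_2\le 1$, i.e. $\lambda=(\lambda_1,1,\dots,1)$. *)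

theory Defs
  imports Main "HOL-Library.Multiset" "HOL-Library.FuncSet"
begin

section \<open>Naturally labeled posets\<close>

definition naturally_labeled_poset :: "nat \<Rightarrow> nat rel \<Rightarrow> bool" where
  "naturally_labeled_poset n P \<longleftrightarrow>
     partial_order_on {1..n} P \<and> (\<forall>x y. (x, y) \<in> P \<longrightarrow> x \<le> y)"

definition poset_isomorphic :: "nat \<Rightarrow> nat rel \<Rightarrow> nat \<Rightarrow> nat rel \<Rightarrow> bool" where
  "poset_isomorphic n P m Q \<longleftrightarrow>
     (\<exists>f. bij_betw f {1..n} {1..m} \<and>
          (\<forall>x\<in>{1..n}. \<forall>y\<in>{1..n}. (x, y) \<in> P \<longleftrightarrow> (f x, f y) \<in> Q))"

section \<open>Formal power series and the P-partition generating function\<close>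

text \<open>
  A formal power series in \<open>x\<^sub>1, x\<^sub>2, \<dots>\<close> with integer coefficients is given by its coefficient
  function.  The monomial \<open>x\<^bsub>i1\<^esub> \<cdots> x\<^bsub>in\<^esub>\<close> is the multiset of its indices; multisets containing
  the index 0 are not monomials in these variables and always get coefficient 0 below.
\<close>

type_synonym series = "nat multiset \<Rightarrow> int"

text \<open>
  Extensional functions are used so that maps on the ground set can be counted; \<open>P_gen_fun n P\<close>
  is \<open>K\<^sub>P\<close>.
\<close>

definition P_partitions :: "nat \<Rightarrow> nat rel \<Rightarrow> (nat \<Rightarrow> nat) set" where
  "P_partitions n P =
     {\<sigma> \<in> {1..n} \<rightarrow>\<^sub>E {1..}. \<forall>x y. (x, y) \<in> P \<longrightarrow> \<sigma> x \<le> \<sigma> y}"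

definition P_gen_fun :: "nat \<Rightarrow> nat rel \<Rightarrow> series" where
  "P_gen_fun n P = (\<lambda>m. int (card {\<sigma> \<in> P_partitions n P. image_mset \<sigma> (mset_set {1..n}) = m}))"

section \<open>The fundamental basis\<close>

definition composition :: "nat list \<Rightarrow> bool" where
  "composition \<alpha> \<longleftrightarrow> (\<forall>a\<in>set \<alpha>. 1 \<le> a)"

definition partial_sums :: "nat list \<Rightarrow> nat set" where
  "partial_sums \<alpha> = {sum_list (take j \<alpha>) | j. 1 \<le> j \<and> j < length \<alpha>}"

text \<open>
  The set \<open>D(\<alpha>)\<close> is \<open>partial_sums \<alpha>\<close> and \<open>L\<^sub>\<alpha>\<close> is \<open>fund_qsym \<alpha>\<close>.
  The list \<open>xs\<close> is the index sequence \<open>i\<^sub>1 \<le> \<cdots> \<le> i\<^sub>n\<close>; list positions start at 0, so that \<open>i\<^sub>s\<close> is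
  \<open>xs ! (s - 1)\<close>.
\<close>

definition fund_qsym :: "nat list \<Rightarrow> series" where
  "fund_qsym \<alpha> = (\<lambda>m. int (card {xs. length xs = sum_list \<alpha> \<and> set xs \<subseteq> {1..} \<and> sorted xs \<and>
                            (\<forall>s\<in>partial_sums \<alpha>. xs ! (s - 1) < xs ! s) \<and> mset xs = m}))"

definition is_L_expansion :: "series \<Rightarrow> (nat list \<Rightarrow> int) \<Rightarrow> bool" where
  "is_L_expansion f c \<longleftrightarrow>
     finite {\<alpha>. c \<alpha> \<noteq> 0} \<and> (\<forall>\<alpha>. c \<alpha> \<noteq> 0 \<longrightarrow> composition \<alpha>) \<and>
     f = (\<lambda>m. \<Sum>\<alpha> | c \<alpha> \<noteq> 0. c \<alpha> * fund_qsym \<alpha> m)"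

text \<open>
  Well defined for quasisymmetric \<open>f\<close> of bounded degree, since the \<open>L\<^sub>\<alpha>\<close> with \<open>\<alpha>\<close> a composition
  form a basis.
\<close>

definition L_coeff :: "series \<Rightarrow> nat list \<Rightarrow> int" where
  "L_coeff f = (THE c. is_L_expansion f c)"

definition supp_L :: "series \<Rightarrow> nat list set" where
  "supp_L f = {\<alpha>. composition \<alpha> \<and> L_coeff f \<alpha> \<noteq> 0}"

section \<open>The shape of a poset\<close>

definition antichain :: "nat \<Rightarrow> nat rel \<Rightarrow> nat set \<Rightarrow> bool" where
  "antichain n P A \<longleftrightarrow> A \<subseteq> {1..n} \<and> (\<forall>x\<in>A. \<forall>y\<in>A. (x, y) \<in> P \<longrightarrow> x = y)"

definition max_antichain_union :: "nat \<Rightarrow> nat rel \<Rightarrow> nat \<Rightarrow> nat" where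
  "max_antichain_union n P i =
     Max {card (\<Union>k<i. A k) | A :: nat \<Rightarrow> nat set. \<forall>k<i. antichain n P (A k)}"

definition int_partition :: "nat list \<Rightarrow> bool" where
  "int_partition \<mu> \<longleftrightarrow> sorted_wrt (\<ge>) \<mu> \<and> (\<forall>a\<in>set \<mu>. 1 \<le> a)"

text \<open>Parts are numbered from 1, with trailing zeros.\<close>

definition part :: "nat list \<Rightarrow> nat \<Rightarrow> nat" where
  "part \<mu> j = (if 1 \<le> j \<and> j \<le> length \<mu> then \<mu> ! (j - 1) else 0)"

definition conjugate_part :: "nat list \<Rightarrow> nat \<Rightarrow> nat" where
  "conjugate_part \<mu> i = card {j \<in> {1..length \<mu>}. i \<le> part \<mu> j}"

text \<open>Existence of the shape is Greene's theorem; uniqueness is immediate.\<close>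

definition shape :: "nat \<Rightarrow> nat rel \<Rightarrow> nat list" where
  "shape n P =
     (THE \<mu>. int_partition \<mu> \<and>
        (\<forall>i. (\<Sum>k = 1..i. conjugate_part \<mu> k) = max_antichain_union n P i))"

definition hook_shaped :: "nat list \<Rightarrow> bool" where
  "hook_shaped \<mu> \<longleftrightarrow> part \<mu> 2 \<le> 1"

end

theory Submission
  imports Defs
begin

text \<open>
  The coefficient of \<open>L\<^sub>\<alpha>\<close> in \<open>K\<^sub>P\<close> counts the linear extensions of \<open>P\<close> with descent set \<open>D(\<alpha>)\<close>,
  so the support is the set of descent sets of linear extensions. That set determines which fibre
  sizes are attained by the strictly order preserving maps on \<open>P\<close>, and with them the height \<open>h\<close> and
  the width of \<open>P\<close>. A hook shape means that some chain \<open>C\<close> with \<open>h\<close> elements and some antichain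
  cover \<open>P\<close> and meet in one element; hence \<open>Q\<close> has the same structure. Then \<open>P\<close> is an interval
  order: \<open>x\<close> is represented by the interval of all its possible values under strict maps to
  \<open>{1..h}\<close>, and any choice of one value from each interval is a strict map. The number of intervals
  contained in \<open>{i..j}\<close> is therefore the least number of elements that a strict map sends to
  \<open>{i..j}\<close>. These numbers determine the multiset of intervals, and so \<open>P\<close> up to isomorphism.
\<close>

section \<open>Compositions and the fundamental basis\<close>

lemma partial_sums_snoc:
  "partial_sums (\<alpha> @ [a]) = (if \<alpha> = [] then {} else insert (sum_list \<alpha>) (partial_sums \<alpha>))"
proof (cases "\<alpha> = []")
  case False
  have "{j. 1 \<le> j \<and> j < length (\<alpha> @ [a])} = insert (length \<alpha>) {j. 1 \<le> j \<and> j < length \<alpha>}"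
    using False by (auto simp: Suc_le_eq)
  moreover have "partial_sums \<beta> = (\<lambda>j. sum_list (take j \<beta>)) ` {j. 1 \<le> j \<and> j < length \<beta>}" for \<beta>
    unfolding partial_sums_def by blast
  ultimately show ?thesis using False by (auto simp del: length_append)
qed (auto simp: partial_sums_def)

lemma partial_sums_Nil [simp]: "partial_sums [] = {}"
  by (simp add: partial_sums_def)

lemma partial_sums_single [simp]: "partial_sums [a] = {}"
  using partial_sums_snoc[of "[]" a] by simp

lemma composition_snoc: "composition (\<alpha> @ [a]) \<longleftrightarrow> composition \<alpha> \<and> 1 \<le> a"
  by (auto simp: composition_def)

lemma composition_sum_list_pos: "composition \<alpha> \<Longrightarrow> \<alpha> \<noteq> [] \<Longrightarrow> 1 \<le> sum_list \<alpha>"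
  by (cases \<alpha>) (auto simp: composition_def)

lemma partial_sums_subset: "composition \<alpha> \<Longrightarrow> partial_sums \<alpha> \<subseteq> {1..<sum_list \<alpha>}"
proof (induction \<alpha> rule: rev_induct)
  case (snoc a \<alpha>)
  then have "composition \<alpha>" "1 \<le> a" "partial_sums \<alpha> \<subseteq> {1..<sum_list \<alpha>}"
    by (auto simp: composition_snoc)
  then show ?case
    using composition_sum_list_pos[of \<alpha>]
    by (cases "\<alpha> = []") (auto simp: partial_sums_snoc subset_iff)
qed simp

lemma finite_partial_sums: "composition \<alpha> \<Longrightarrow> finite (partial_sums \<alpha>)"
  by (meson partial_sums_subset finite_subset finite_atLeastLessThan)

lemma card_partial_sums: "composition \<alpha> \<Longrightarrow> card (partial_sums \<alpha>) = length \<alpha> - 1"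
proof (induction \<alpha> rule: rev_induct)
  case (snoc a \<alpha>)
  then have "sum_list \<alpha> \<notin> partial_sums \<alpha>" "finite (partial_sums \<alpha>)"
    using partial_sums_subset[of \<alpha>] finite_partial_sums[of \<alpha>] by (auto simp: composition_snoc)
  moreover have "card (partial_sums \<alpha>) = length \<alpha> - 1" using snoc by (simp add: composition_snoc)
  ultimately show ?case by (cases "\<alpha> = []") (simp_all add: partial_sums_snoc Suc_pred)
qed simp

lemma Max_partial_sums_snoc:
  assumes "composition \<alpha>" "\<alpha> \<noteq> []"
  shows "Max (partial_sums (\<alpha> @ [a])) = sum_list \<alpha>"
proof (rule Max_eqI)
  show "finite (partial_sums (\<alpha> @ [a]))" "sum_list \<alpha> \<in> partial_sums (\<alpha> @ [a])"
    using finite_partial_sums[OF assms(1)] assms(2) by (simp_all add: partial_sums_snoc)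
  show "k \<le> sum_list \<alpha>" if "k \<in> partial_sums (\<alpha> @ [a])" for k
    using that partial_sums_subset[OF assms(1)] assms(2)
    by (auto simp: partial_sums_snoc subset_iff)
qed

lemma composition_eqI:
  "\<lbrakk>composition \<alpha>; composition \<beta>; sum_list \<alpha> = sum_list \<beta>; partial_sums \<alpha> = partial_sums \<beta>\<rbrakk> \<Longrightarrow> \<alpha> = \<beta>"
proof (induction \<alpha> arbitrary: \<beta> rule: rev_induct)
  case Nil
  then show ?case using composition_sum_list_pos[of \<beta>] by (metis not_one_le_zero sum_list.Nil)
next
  case (snoc a \<alpha>)
  have "\<beta> \<noteq> []" using snoc.prems(1,3) by (auto simp: composition_snoc)
  then obtain \<gamma> b where \<beta>: "\<beta> = \<gamma> @ [b]" by (metis rev_exhaust)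
  have comp: "composition \<alpha>" "composition \<gamma>" using snoc.prems by (auto simp: \<beta> composition_snoc)
  have ps: "partial_sums (\<alpha> @ [a]) = partial_sums (\<gamma> @ [b])" using snoc.prems by (simp add: \<beta>)
  have emp: "\<alpha> = [] \<longleftrightarrow> \<gamma> = []" using ps unfolding partial_sums_snoc by (metis insert_not_empty)
  show ?case
  proof (cases "\<alpha> = []")
    case True
    then show ?thesis using emp snoc.prems(3) by (simp add: \<beta>)
  next
    case False
    have "\<gamma> \<noteq> []" using False emp by simp
    have s: "sum_list \<alpha> = sum_list \<gamma>"
      using Max_partial_sums_snoc[OF comp(1) False, of a]
        Max_partial_sums_snoc[OF comp(2) \<open>\<gamma> \<noteq> []\<close>, of b] unfolding ps by (rule trans[OF sym])
    have "partial_sums \<alpha> = partial_sums (\<alpha> @ [a]) - {sum_list \<alpha>}"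
      using False partial_sums_subset[OF comp(1)] by (auto simp: partial_sums_snoc)
    moreover have "partial_sums \<gamma> = partial_sums (\<gamma> @ [b]) - {sum_list \<gamma>}"
      using False emp partial_sums_subset[OF comp(2)] by (auto simp: partial_sums_snoc)
    ultimately have "partial_sums \<alpha> = partial_sums \<gamma>" unfolding ps s by simp
    then have "\<alpha> = \<gamma>" using snoc.IH comp s by blast
    then show ?thesis using snoc.prems(3) by (simp add: \<beta>)
  qed
qed

lemma ex_composition:
  "D \<subseteq> {1..<n} \<Longrightarrow> \<exists>\<alpha>. composition \<alpha> \<and> sum_list \<alpha> = n \<and> partial_sums \<alpha> = D"
proof (induction n arbitrary: D rule: less_induct)
  case (less n)
  have fin: "finite D" using less.prems finite_subset by blast
  consider "n = 0" | "n > 0" "D = {}" | "D \<noteq> {}" by auto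
  then show ?case
  proof cases
    case 1
    then show ?thesis using less.prems by (intro exI[of _ "[]"]) (auto simp: composition_def)
  next
    case 2
    then show ?thesis
      by (intro exI[of _ "[n]"]) (auto simp: composition_def partial_sums_def)
  next
    case 3
    define k where "k = Max D"
    have kD: "k \<in> D" unfolding k_def using fin 3 by simp
    have k: "1 \<le> k" "k < n" using kD less.prems by auto
    have "x < k" if "x \<in> D - {k}" for x
      using that fin Max_ge[of D x] by (auto simp: k_def order.strict_iff_order)
    then have "D - {k} \<subseteq> {1..<k}" using less.prems by (meson Diff_subset atLeastLessThan_iff subset_iff)
    from less.IH[OF k(2) this] obtain \<alpha>
      where \<alpha>: "composition \<alpha>" "sum_list \<alpha> = k" "partial_sums \<alpha> = D - {k}"
      by (elim exE conjE)
    have "\<alpha> \<noteq> []" using k(1) \<alpha>(2) by force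
    then have "partial_sums (\<alpha> @ [n - k]) = D"
      unfolding partial_sums_snoc \<alpha> using kD by (simp add: insert_absorb)
    moreover have "composition (\<alpha> @ [n - k])" "sum_list (\<alpha> @ [n - k]) = n"
      using \<alpha>(1,2) k by (simp_all add: composition_snoc)
    ultimately show ?thesis by blast
  qed
qed

definition strict_at :: "nat set \<Rightarrow> nat multiset \<Rightarrow> bool" where
  "strict_at D m \<longleftrightarrow> 0 \<notin># m \<and>
     (\<forall>s\<in>D. sorted_list_of_multiset m ! (s - 1) < sorted_list_of_multiset m ! s)"

lemma fund_qsym_eq:
  "fund_qsym \<alpha> m = (if size m = sum_list \<alpha> \<and> strict_at (partial_sums \<alpha>) m then 1 else 0)"
proof -
  let ?S = "{xs. length xs = sum_list \<alpha> \<and> set xs \<subseteq> {1..} \<and> sorted xs \<and>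
              (\<forall>s\<in>partial_sums \<alpha>. xs ! (s - 1) < xs ! s) \<and> mset xs = m}"
  define ys where "ys = sorted_list_of_multiset m"
  have ys: "sorted ys" "mset ys = m" by (simp_all add: ys_def)
  have len: "length ys = size m" unfolding ys(2)[symmetric] by simp
  have set: "set ys \<subseteq> {1..} \<longleftrightarrow> 0 \<notin># m"
    unfolding ys(2)[symmetric] set_mset_mset subset_iff atLeast_iff
    by (metis One_nat_def Suc_leI gr0I not_one_le_zero)
  define S where "S = ?S"
  have S_iff: "xs \<in> S \<longleftrightarrow> length xs = sum_list \<alpha> \<and> set xs \<subseteq> {1..} \<and> sorted xs \<and>
      (\<forall>s\<in>partial_sums \<alpha>. xs ! (s - 1) < xs ! s) \<and> mset xs = m" for xs
    unfolding S_def by (rule mem_Collect_eq)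
  have S_ys: "xs = ys" if "xs \<in> S" for xs
  proof -
    have "sorted xs" "mset ys = mset xs" using that ys(2) unfolding S_iff by (fast, metis)
    then show ?thesis using properties_for_sort[of xs ys] sorted_sort_id[OF ys(1)] by simp
  qed
  have "ys \<in> S \<longleftrightarrow> size m = sum_list \<alpha> \<and> strict_at (partial_sums \<alpha>) m"
    unfolding strict_at_def S_iff ys_def[symmetric] set len using ys by fast
  moreover have "S = (if ys \<in> S then {ys} else {})"
    by (cases "ys \<in> S"; simp only: if_True if_False; insert S_ys; blast)
  ultimately have "card S = (if size m = sum_list \<alpha> \<and> strict_at (partial_sums \<alpha>) m then 1 else 0)"
    by (metis card.empty card_1_singleton_iff One_nat_def)
  then show ?thesis unfolding fund_qsym_def S_def by simp
qed

lemma separating_multiset: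
  assumes "D \<subseteq> {1..<n}"
  obtains m where "size m = n" "\<And>E. E \<subseteq> {1..<n} \<Longrightarrow> strict_at E m \<longleftrightarrow> E \<subseteq> D"
proof -
  define g where "g t = Suc (card {s\<in>D. s \<le> t})" for t
  define xs where "xs = map g [0..<n]"
  have fin: "finite D" using assms finite_subset by blast
  have g_mono: "g s \<le> g t" if "s \<le> t" for s t
    unfolding g_def using fin that by (auto intro!: card_mono)
  have "sorted xs" unfolding xs_def sorted_wrt_map
    by (rule sorted_wrt_mono_rel[OF _ sorted_upt]) (use g_mono in auto)
  then have sl: "sorted_list_of_multiset (mset xs) = xs"
    by (simp add: sorted_sort_id)
  have step: "g (s - 1) < g s \<longleftrightarrow> s \<in> D" if "1 \<le> s" for s
  proof (cases "s \<in> D")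
    case True
    then have "s \<in> {t\<in>D. t \<le> s} - {t\<in>D. t \<le> s - 1}" using that by auto
    then have "card {t\<in>D. t \<le> s - 1} < card {t\<in>D. t \<le> s}"
      using fin by (intro psubset_card_mono) (simp, fastforce)
    then show ?thesis using True by (simp add: g_def)
  next
    case False
    then have "{t\<in>D. t \<le> s - 1} = {t\<in>D. t \<le> s}" using that by (auto simp: le_less)
    then show ?thesis using False by (simp add: g_def)
  qed
  have "strict_at E (mset xs) \<longleftrightarrow> E \<subseteq> D" if "E \<subseteq> {1..<n}" for E
  proof -
    have "0 \<notin> set xs" by (auto simp: xs_def g_def)
    moreover have "xs ! (s - 1) < xs ! s \<longleftrightarrow> s \<in> D" if "s \<in> E" for s
    proof -
      have "1 \<le> s" "s < n" using that \<open>E \<subseteq> {1..<n}\<close> by auto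
      then show ?thesis using step[of s] by (simp add: xs_def)
    qed
    ultimately show ?thesis unfolding strict_at_def sl by auto
  qed
  moreover have "size (mset xs) = n" by (simp add: xs_def)
  ultimately show ?thesis using that by blast
qed

lemma is_L_expansion_unique:
  assumes c: "is_L_expansion f c" and c': "is_L_expansion f c'"
  shows "c = c'"
proof
  define T where "T = {\<alpha>. c \<alpha> \<noteq> 0} \<union> {\<alpha>. c' \<alpha> \<noteq> 0}"
  have finT: "finite T" using c c' by (auto simp: T_def is_L_expansion_def)
  have compT: "composition \<alpha>" if "\<alpha> \<in> T" for \<alpha> using that c c' by (auto simp: T_def is_L_expansion_def)
  have "f m = (\<Sum>\<alpha>\<in>T. c \<alpha> * fund_qsym \<alpha> m)" "f m = (\<Sum>\<alpha>\<in>T. c' \<alpha> * fund_qsym \<alpha> m)" for m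
  proof -
    have "f m = (\<Sum>\<alpha> | c \<alpha> \<noteq> 0. c \<alpha> * fund_qsym \<alpha> m)" using c unfolding is_L_expansion_def by meson
    then show "f m = (\<Sum>\<alpha>\<in>T. c \<alpha> * fund_qsym \<alpha> m)"
      using finT by (simp only:) (rule sum.mono_neutral_left, auto simp: T_def)
    have "f m = (\<Sum>\<alpha> | c' \<alpha> \<noteq> 0. c' \<alpha> * fund_qsym \<alpha> m)" using c' unfolding is_L_expansion_def by meson
    then show "f m = (\<Sum>\<alpha>\<in>T. c' \<alpha> * fund_qsym \<alpha> m)"
      using finT by (simp only:) (rule sum.mono_neutral_left, auto simp: T_def)
  qed
  then have zero: "(\<Sum>\<alpha>\<in>T. (c \<alpha> - c' \<alpha>) * fund_qsym \<alpha> m) = 0" for m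
    unfolding left_diff_distrib sum_subtractf by (metis diff_self)
  show "c \<alpha> = c' \<alpha>" for \<alpha>
  proof (induction \<alpha> rule: length_induct)
    case (1 \<alpha>)
    show ?case
    proof (cases "\<alpha> \<in> T")
      case True
      obtain m where m: "size m = sum_list \<alpha>"
        "\<And>E. E \<subseteq> {1..<sum_list \<alpha>} \<Longrightarrow> strict_at E m \<longleftrightarrow> E \<subseteq> partial_sums \<alpha>"
        using separating_multiset[OF partial_sums_subset[OF compT[OF True]]] by blast
      have "(c \<beta> - c' \<beta>) * fund_qsym \<beta> m = 0" if \<beta>: "\<beta> \<in> T - {\<alpha>}" for \<beta>
      proof (cases "length \<beta> < length \<alpha>")
        case False
        have "\<not> (sum_list \<alpha> = sum_list \<beta> \<and> partial_sums \<beta> \<subseteq> partial_sums \<alpha>)"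
        proof
          assume *: "sum_list \<alpha> = sum_list \<beta> \<and> partial_sums \<beta> \<subseteq> partial_sums \<alpha>"
          have "card (partial_sums \<alpha>) \<le> card (partial_sums \<beta>)"
            using \<beta> True False compT by (simp add: card_partial_sums)
          then have "partial_sums \<beta> = partial_sums \<alpha>"
            using * True compT finite_partial_sums by (meson card_seteq)
          then show False using * \<beta> True compT composition_eqI[of \<alpha> \<beta>] by auto
        qed
        then have "fund_qsym \<beta> m = 0"
          using m partial_sums_subset[OF compT[of \<beta>]] \<beta> by (auto simp: fund_qsym_eq)
        then show ?thesis by simp
      qed (use 1 in simp)
      then have "(\<Sum>\<beta>\<in>T - {\<alpha>}. (c \<beta> - c' \<beta>) * fund_qsym \<beta> m) = 0"
        by (rule sum.neutral[OF ballI])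
      then have "(\<Sum>\<beta>\<in>T. (c \<beta> - c' \<beta>) * fund_qsym \<beta> m) = (c \<alpha> - c' \<alpha>) * fund_qsym \<alpha> m"
        using sum.remove[OF finT True, of "\<lambda>\<beta>. (c \<beta> - c' \<beta>) * fund_qsym \<beta> m"] by simp
      moreover have "fund_qsym \<alpha> m = 1"
        using m partial_sums_subset[OF compT[OF True]] by (simp add: fund_qsym_eq)
      ultimately show ?thesis using zero by simp
    qed (auto simp: T_def)
  qed
qed

section \<open>Linear extensions\<close>

definition lin_ext :: "nat \<Rightarrow> nat rel \<Rightarrow> nat list set" where
  "lin_ext n P = {p. distinct p \<and> set p = {1..n} \<and> sorted_wrt (\<lambda>x y. (y, x) \<notin> P) p}"

definition descents :: "nat list \<Rightarrow> nat set" where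
  "descents p = {s\<in>{1..<length p}. p ! s < p ! (s - 1)}"

lemma lin_ext_length: "p \<in> lin_ext n P \<Longrightarrow> length p = n"
  unfolding lin_ext_def using distinct_card by fastforce

lemma finite_lin_ext: "finite (lin_ext n P)"
proof (rule finite_subset)
  show "lin_ext n P \<subseteq> {p. set p \<subseteq> {1..n} \<and> length p = n}"
    using lin_ext_length by (auto simp: lin_ext_def)
qed (simp add: finite_lists_length_eq)

lemma descents_subset: "p \<in> lin_ext n P \<Longrightarrow> descents p \<subseteq> {1..<n}"
  by (auto simp: descents_def dest: lin_ext_length)

lemma pair_code_less_iff:
  fixes a b c d n :: nat
  assumes "b \<le> n" "d \<le> n"
  shows "a * Suc n + b < c * Suc n + d \<longleftrightarrow> a < c \<or> a = c \<and> b < d"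
proof -
  have less: "x * Suc n + y < x' * Suc n + y'" if "x < x'" "y \<le> n" for x x' y y' :: nat
    using mult_le_mono1[of "Suc x" x' "Suc n"] that by simp
  consider "a < c" | "c < a" | "a = c" by linarith
  then show ?thesis
    by cases (use less[of a c b d] less[of c a d b] assms in auto)
qed

locale nat_poset =
  fixes n :: nat and P :: "nat rel"
  assumes naturally_labeled: "naturally_labeled_poset n P"
begin

lemma partial_order: "partial_order_on {1..n} P"
  using naturally_labeled by (simp add: naturally_labeled_poset_def)

lemma le: "(x, y) \<in> P \<Longrightarrow> x \<le> y"
  using naturally_labeled by (simp add: naturally_labeled_poset_def)

lemma in_ground: "(x, y) \<in> P \<Longrightarrow> x \<in> {1..n} \<and> y \<in> {1..n}"
  using partial_order by (auto simp: partial_order_on_def preorder_on_def refl_on_def)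

lemma refl: "x \<in> {1..n} \<Longrightarrow> (x, x) \<in> P"
  using partial_order by (auto simp: partial_order_on_def preorder_on_def refl_on_def)

lemma trans: "(x, y) \<in> P \<Longrightarrow> (y, z) \<in> P \<Longrightarrow> (x, z) \<in> P"
  using partial_order by (meson partial_order_on_def preorder_on_def transE)

lemma antisym: "(x, y) \<in> P \<Longrightarrow> (y, x) \<in> P \<Longrightarrow> x = y"
  using le[of x y] le[of y x] by simp

lemma ex_sorted_lin_ext:
  fixes f t :: "nat \<Rightarrow> nat"
  assumes t: "inj_on t {1..n}" "\<And>x. x \<in> {1..n} \<Longrightarrow> t x \<le> n"
    and mono: "\<And>x y. (x, y) \<in> P \<Longrightarrow> x \<noteq> y \<Longrightarrow> f x < f y \<or> f x = f y \<and> t x < t y"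
  obtains p where "p \<in> lin_ext n P"
    "sorted_wrt (\<lambda>x y. f x < f y \<or> f x = f y \<and> t x < t y) p"
proof -
  define K where "K x = f x * Suc n + t x" for x
  define p where "p = sort_key K [1..<Suc n]"
  have K: "K x < K y \<longleftrightarrow> f x < f y \<or> f x = f y \<and> t x < t y" if "x \<in> {1..n}" "y \<in> {1..n}" for x y
    unfolding K_def using that t(2) by (intro pair_code_less_iff) auto
  have "inj_on K {1..n}"
  proof (rule inj_onI)
    fix x y assume xy: "x \<in> {1..n}" "y \<in> {1..n}" "K x = K y"
    then have "\<not> K x < K y" "\<not> K y < K x" by simp_all
    then have "t x = t y" using xy K by (metis linorder_neqE_nat)
    then show "x = y" using t(1) xy by (simp add: inj_on_eq_iff)
  qed
  moreover have p: "set p = {1..n}" "distinct p" by (auto simp: p_def)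
  ultimately have "distinct (map K p)" by (simp add: distinct_map)
  moreover have "sorted (map K p)" by (simp add: p_def)
  ultimately have "sorted_wrt (<) (map K p)" by (simp add: strict_sorted_iff)
  then have "sorted_wrt (\<lambda>x y. K x < K y) p" by (simp add: sorted_wrt_map)
  then have *: "sorted_wrt (\<lambda>x y. f x < f y \<or> f x = f y \<and> t x < t y) p"
    by (rule sorted_wrt_mono_rel[rotated]) (use K p in auto)
  have "sorted_wrt (\<lambda>x y. (y, x) \<notin> P) p"
    by (rule sorted_wrt_mono_rel[OF _ *]) (use mono in fastforce)
  with p * show ?thesis by (intro that) (simp_all add: lin_ext_def)
qed

end

text \<open>Sorting the ground set by \<open>\<sigma>\<close>, with ties broken by the labels, yields exactly one list that
  fits \<open>\<sigma>\<close>.\<close>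

definition fits :: "nat list \<Rightarrow> (nat \<Rightarrow> nat) \<Rightarrow> bool" where
  "fits p \<sigma> \<longleftrightarrow> sorted_wrt (\<lambda>x y. \<sigma> x < \<sigma> y \<or> \<sigma> x = \<sigma> y \<and> x < y) p"

lemma fits_iff_descents:
  assumes "distinct p"
  shows "fits p \<sigma> \<longleftrightarrow> sorted (map \<sigma> p) \<and> (\<forall>s\<in>descents p. \<sigma> (p ! (s - 1)) < \<sigma> (p ! s))"
proof -
  have tr: "transp (\<lambda>x y. \<sigma> x < \<sigma> y \<or> \<sigma> x = \<sigma> y \<and> x < y)" by (auto intro!: transpI)
  have neq: "p ! i \<noteq> p ! Suc i" if "Suc i < length p" for i
    using assms that by (simp add: nth_eq_iff_index_eq)
  have "(\<forall>s\<in>descents p. \<sigma> (p ! (s - 1)) < \<sigma> (p ! s)) \<longleftrightarrow>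
    (\<forall>i. Suc i < length p \<longrightarrow> p ! Suc i < p ! i \<longrightarrow> \<sigma> (p ! i) < \<sigma> (p ! Suc i))" (is "?L = ?R")
  proof
    assume ?L
    show ?R
    proof (intro allI impI)
      fix i assume "Suc i < length p" "p ! Suc i < p ! i"
      then have "Suc i \<in> descents p" by (simp add: descents_def)
      with \<open>?L\<close> show "\<sigma> (p ! i) < \<sigma> (p ! Suc i)" by fastforce
    qed
  next
    assume ?R
    show ?L
    proof
      fix s assume s: "s \<in> descents p"
      then obtain i where "s = Suc i" by (cases s) (auto simp: descents_def)
      with s \<open>?R\<close> show "\<sigma> (p ! (s - 1)) < \<sigma> (p ! s)" by (simp add: descents_def)
    qed
  qed
  moreover have "sorted (map \<sigma> p) \<longleftrightarrow> (\<forall>i. Suc i < length p \<longrightarrow> \<sigma> (p ! i) \<le> \<sigma> (p ! Suc i))"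
    by (simp add: sorted_iff_nth_Suc)
  ultimately show ?thesis
    unfolding fits_def sorted_wrt_iff_nth_Suc_transp[OF tr]
    using neq by (metis le_less linorder_neqE_nat not_less_iff_gr_or_eq)
qed

context nat_poset
begin

lemma ex1_fits:
  assumes "\<sigma> \<in> P_partitions n P"
  shows "\<exists>!p. p \<in> lin_ext n P \<and> fits p \<sigma>"
proof -
  let ?R = "\<lambda>x y. \<sigma> x < \<sigma> y \<or> \<sigma> x = \<sigma> y \<and> x < y"
  have R: "?R x y" if "(x, y) \<in> P" "x \<noteq> y" for x y
    using assms le[OF that(1)] that by (auto simp: P_partitions_def le_less)
  obtain p where p: "p \<in> lin_ext n P" "sorted_wrt ?R p"
    by (rule ex_sorted_lin_ext[of "\<lambda>x. x" \<sigma>, OF _ _ R]) auto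
  have "q = p" if q: "q \<in> lin_ext n P" "sorted_wrt ?R q" for q
  proof -
    have "distinct p" "distinct q" "set p = set q" using p q by (simp_all add: lin_ext_def)
    then show ?thesis using p(2) q(2)
    proof (induction p arbitrary: q)
      case (Cons a p)
      then obtain b q' where q: "q = b # q'" by (cases q) auto
      have "a = b"
      proof (rule ccontr)
        assume "a \<noteq> b"
        then have "a \<in> set q'" "b \<in> set p" using Cons.prems(3) unfolding q by auto
        then have "?R a b" "?R b a" using Cons.prems(4,5) unfolding q by auto
        then show False by auto
      qed
      moreover have "set p = set q'"
        using Cons.prems(1,2,3) \<open>a = b\<close> unfolding q by (auto simp: insert_ident)
      then have "q' = p" using Cons.prems unfolding q by (intro Cons.IH) simp_all
      ultimately show ?case by (simp add: q)
    qed simp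
  qed
  then show ?thesis using p unfolding fits_def by blast
qed

lemma P_gen_fun_eq:
  "P_gen_fun n P m = int (card {p\<in>lin_ext n P. size m = n \<and> strict_at (descents p) m})"
proof -
  let ?S = "{\<sigma> \<in> P_partitions n P. image_mset \<sigma> (mset_set {1..n}) = m}"
  let ?L = "{p\<in>lin_ext n P. size m = n \<and> strict_at (descents p) m}"
  define xs where "xs = sorted_list_of_multiset m"
  have mset_xs: "mset xs = m" "sorted xs" by (simp_all add: xs_def)
  have mset_p: "mset p = mset_set {1..n}" if "p \<in> lin_ext n P" for p
    using that mset_set_set[of p] by (simp add: lin_ext_def)
  have map_p: "map \<sigma> p = xs" if "\<sigma> \<in> ?S" "p \<in> lin_ext n P" "fits p \<sigma>" for \<sigma> p
  proof -
    have "mset (map \<sigma> p) = mset xs" using that mset_p[OF that(2)] mset_xs by simp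
    moreover have "sorted (map \<sigma> p)"
      using that by (simp add: fits_iff_descents lin_ext_def)
    ultimately show ?thesis
      using properties_for_sort[of "map \<sigma> p" xs] sorted_sort_id[OF mset_xs(2)] by simp
  qed
  have descents_lt: "s - 1 < length p" "s < length p" if "s \<in> descents p" for s p
    using that by (auto simp: descents_def)
  have to_L: "p \<in> ?L" if \<sigma>: "\<sigma> \<in> ?S" and p: "p \<in> lin_ext n P" "fits p \<sigma>" for \<sigma> p
  proof -
    have "0 \<notin># m" using \<sigma> by (force simp: P_partitions_def PiE_iff)
    moreover have "size m = n" using \<sigma> by auto
    moreover have "xs ! (s - 1) < xs ! s" if "s \<in> descents p" for s
      using p that descents_lt[OF that] unfolding map_p[OF \<sigma> p, symmetric]
      by (simp add: fits_iff_descents lin_ext_def)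
    ultimately show ?thesis using p by (simp add: strict_at_def xs_def)
  qed
  have from_L: "\<exists>\<sigma>\<in>?S. fits p \<sigma>" if p: "p \<in> ?L" for p
  proof -
    have pL: "p \<in> lin_ext n P" "size m = n" "strict_at (descents p) m" using p by auto
    have dist: "distinct p" "set p = {1..n}" "length p = n"
      using pL lin_ext_length by (auto simp: lin_ext_def)
    have len: "length xs = n" using pL(2) unfolding mset_xs(1)[symmetric] by simp
    define \<sigma> where "\<sigma> = restrict (\<lambda>x. xs ! inv_into {..<n} ((!) p) x) {1..n}"
    have bij: "bij_betw ((!) p) {..<n} {1..n}" using dist by (intro bij_betw_nth) auto
    have \<sigma>: "\<sigma> (p ! i) = xs ! i" if "i < n" for i
      using bij that bij_betwE[OF bij] by (auto simp: \<sigma>_def bij_betw_inv_into_left)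
    have map\<sigma>: "map \<sigma> p = xs" using dist len \<sigma> by (intro nth_equalityI) auto
    have img: "image_mset \<sigma> (mset_set {1..n}) = m"
      unfolding mset_p[OF pL(1), symmetric] mset_map[symmetric] map\<sigma> by (rule mset_xs)
    have "0 \<notin># m" using pL(3) by (simp add: strict_at_def)
    moreover have "\<sigma> x \<in># m" if "x \<in> {1..n}" for x
      unfolding img[symmetric] using that by simp
    ultimately have "0 < \<sigma> x" if "x \<in> {1..n}" for x using that by (metis gr0I)
    then have "\<sigma> \<in> {1..n} \<rightarrow>\<^sub>E {1..}" by (auto simp: \<sigma>_def Suc_le_eq)
    moreover have "\<sigma> x \<le> \<sigma> y" if xy: "(x, y) \<in> P" for x y
    proof -
      obtain i j where ij: "i < n" "x = p ! i" "j < n" "y = p ! j"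
        using in_ground[OF xy] dist by (metis in_set_conv_nth)
      have "\<not> j < i"
        using pL(1) ij xy dist sorted_wrt_nth_less[of "\<lambda>x y. (y, x) \<notin> P" p j i] by (auto simp: lin_ext_def)
      then show ?thesis using ij \<sigma> mset_xs(2) len by (simp add: sorted_nth_mono)
    qed
    ultimately have "\<sigma> \<in> ?S" using img by (simp add: P_partitions_def)
    moreover have "fits p \<sigma>"
      unfolding fits_iff_descents[OF dist(1)] map\<sigma>
    proof (intro conjI ballI mset_xs)
      fix s assume s: "s \<in> descents p"
      then show "\<sigma> (p ! (s - 1)) < \<sigma> (p ! s)"
        using descents_lt[OF s] dist(3) \<sigma> pL(3) by (simp add: strict_at_def xs_def)
    qed
    ultimately show ?thesis by blast
  qed
  define F where "F \<sigma> = (THE p. p \<in> lin_ext n P \<and> fits p \<sigma>)" for \<sigma>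
  have F: "F \<sigma> \<in> lin_ext n P \<and> fits (F \<sigma>) \<sigma>" if "\<sigma> \<in> ?S" for \<sigma>
    unfolding F_def by (rule theI'[OF ex1_fits]) (use that in simp)
  have F_eq: "F \<sigma> = p" if "\<sigma> \<in> ?S" "p \<in> lin_ext n P" "fits p \<sigma>" for \<sigma> p
    using ex1_fits[of \<sigma>] F[OF that(1)] that by blast
  have "bij_betw F ?S ?L"
    unfolding bij_betw_def
  proof
    show "inj_on F ?S"
    proof (rule inj_onI)
      fix \<sigma> \<tau> assume st: "\<sigma> \<in> ?S" "\<tau> \<in> ?S" "F \<sigma> = F \<tau>"
      have "map \<sigma> (F \<sigma>) = xs" using map_p[OF st(1)] F[OF st(1)] by blast
      moreover have "map \<tau> (F \<tau>) = xs" using map_p[OF st(2)] F[OF st(2)] by blast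
      ultimately have "map \<sigma> (F \<sigma>) = map \<tau> (F \<sigma>)" using st(3) by simp
      moreover have "set (F \<sigma>) = {1..n}" using F[OF st(1)] by (simp add: lin_ext_def)
      ultimately have "\<sigma> x = \<tau> x" if "x \<in> {1..n}" for x using that by simp
      moreover have "\<sigma> \<in> extensional {1..n}" "\<tau> \<in> extensional {1..n}"
        using st by (simp_all add: P_partitions_def PiE_def)
      ultimately show "\<sigma> = \<tau>" by (rule extensionalityI[rotated 2])
    qed
    show "F ` ?S = ?L"
    proof (intro equalityI subsetI)
      fix p assume "p \<in> F ` ?S"
      then obtain \<sigma> where "\<sigma> \<in> ?S" "p = F \<sigma>" by (rule imageE)
      then show "p \<in> ?L" using F to_L by blast
    next
      fix p assume p: "p \<in> ?L"
      obtain \<sigma> where \<sigma>: "\<sigma> \<in> ?S" "fits p \<sigma>" using from_L[OF p] by (rule bexE)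
      have "p \<in> lin_ext n P" using p by simp
      then have "p = F \<sigma>" using F_eq[OF \<sigma>(1) _ \<sigma>(2)] by simp
      then show "p \<in> F ` ?S" using \<sigma>(1) by (rule image_eqI)
    qed
  qed
  then show ?thesis unfolding P_gen_fun_def by (simp add: bij_betw_same_card)
qed

lemma supp_L_P_gen_fun:
  "supp_L (P_gen_fun n P) =
    {\<alpha>. composition \<alpha> \<and> sum_list \<alpha> = n \<and> partial_sums \<alpha> \<in> descents ` lin_ext n P}"
proof -
  have "\<forall>p\<in>lin_ext n P. \<exists>\<alpha>. composition \<alpha> \<and> sum_list \<alpha> = n \<and> partial_sums \<alpha> = descents p"
    by (intro ballI ex_composition descents_subset)
  from bchoice[OF this] obtain cp where
    cp: "\<And>p. p \<in> lin_ext n P \<Longrightarrow> composition (cp p)" "\<And>p. p \<in> lin_ext n P \<Longrightarrow> sum_list (cp p) = n"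
      "\<And>p. p \<in> lin_ext n P \<Longrightarrow> partial_sums (cp p) = descents p" by blast
  define c where "c \<alpha> = int (card {p\<in>lin_ext n P. cp p = \<alpha>})" for \<alpha>
  have c_nz: "c \<alpha> \<noteq> 0 \<longleftrightarrow> \<alpha> \<in> cp ` lin_ext n P" for \<alpha>
    using finite_lin_ext[of n P] by (auto simp: c_def)
  have c: "is_L_expansion (P_gen_fun n P) c"
    unfolding is_L_expansion_def c_nz
  proof (intro conjI ext)
    show "finite {\<alpha>. \<alpha> \<in> cp ` lin_ext n P}" using finite_lin_ext by simp
    show "\<forall>\<alpha>. \<alpha> \<in> cp ` lin_ext n P \<longrightarrow> composition \<alpha>" using cp by blast
    fix m
    have "P_gen_fun n P m = (\<Sum>p\<in>lin_ext n P. fund_qsym (cp p) m)"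
    proof -
      have "(\<Sum>p\<in>lin_ext n P. fund_qsym (cp p) m) =
          (\<Sum>p\<in>lin_ext n P. if size m = n \<and> strict_at (descents p) m then 1 else 0)"
        using cp by (intro sum.cong) (simp_all add: fund_qsym_eq)
      also have "\<dots> = int (card {p\<in>lin_ext n P. size m = n \<and> strict_at (descents p) m})"
        using finite_lin_ext[of n P] by (simp add: sum.If_cases Int_def)
      finally show ?thesis by (simp add: P_gen_fun_eq)
    qed
    also have "\<dots> = (\<Sum>\<alpha>\<in>cp ` lin_ext n P. \<Sum>p | p \<in> lin_ext n P \<and> cp p = \<alpha>. fund_qsym (cp p) m)"
      by (rule sum.image_gen[OF finite_lin_ext])
    also have "\<dots> = (\<Sum>\<alpha> | \<alpha> \<in> cp ` lin_ext n P. c \<alpha> * fund_qsym \<alpha> m)"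
      unfolding Collect_mem_eq by (intro sum.cong) (simp_all add: c_def)
    finally show "P_gen_fun n P m = (\<Sum>\<alpha> | \<alpha> \<in> cp ` lin_ext n P. c \<alpha> * fund_qsym \<alpha> m)" .
  qed
  have "L_coeff (P_gen_fun n P) = c"
    unfolding L_coeff_def using c is_L_expansion_unique[OF _ c] by (rule the_equality)
  then have "supp_L (P_gen_fun n P) = cp ` lin_ext n P"
    unfolding supp_L_def using cp(1) by (simp only: c_nz) blast
  also have "\<dots> = {\<alpha>. composition \<alpha> \<and> sum_list \<alpha> = n \<and> partial_sums \<alpha> \<in> descents ` lin_ext n P}"
  proof (intro equalityI subsetI)
    fix \<alpha> assume "\<alpha> \<in> cp ` lin_ext n P"
    then show "\<alpha> \<in> {\<alpha>. composition \<alpha> \<and> sum_list \<alpha> = n \<and> partial_sums \<alpha> \<in> descents ` lin_ext n P}"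
      using cp by auto
  next
    fix \<alpha> assume "\<alpha> \<in> {\<alpha>. composition \<alpha> \<and> sum_list \<alpha> = n \<and> partial_sums \<alpha> \<in> descents ` lin_ext n P}"
    then obtain p where p: "p \<in> lin_ext n P"
      and \<alpha>: "composition \<alpha>" "sum_list \<alpha> = n" "partial_sums \<alpha> = descents p" by blast
    have "\<alpha> = cp p" using \<alpha> cp[OF p] by (intro composition_eqI) simp_all
    then show "\<alpha> \<in> cp ` lin_ext n P" using p by (rule image_eqI)
  qed
  finally show ?thesis .
qed

end
section \<open>Strict maps\<close>

definition strict_map :: "nat rel \<Rightarrow> (nat \<Rightarrow> nat) \<Rightarrow> bool" where
  "strict_map P f \<longleftrightarrow> (\<forall>x y. (x, y) \<in> P \<and> x \<noteq> y \<longrightarrow> f x < f y)"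

text \<open>The descents of a linear extension along which \<open>f\<close> is weakly increasing, with each fibre of \<open>f\<close>
  listed in decreasing order, already decide which maps of the form \<open>f \<circ> \<phi>\<close> are strict.\<close>

lemma strict_map_transfer:
  assumes P: "nat_poset n P" and Q: "nat_poset n Q"
    and sub: "descents ` lin_ext n P \<subseteq> descents ` lin_ext n Q"
    and f: "strict_map P f"
  obtains \<phi> where "bij_betw \<phi> {1..n} {1..n}" "strict_map Q (f \<circ> \<phi>)"
proof -
  interpret P: nat_poset n P by fact
  interpret Q: nat_poset n Q by fact
  let ?R = "\<lambda>x y. f x < f y \<or> f x = f y \<and> n - x < n - y"
  have R: "?R x y" if "(x, y) \<in> P" "x \<noteq> y" for x y
    using f that unfolding strict_map_def by blast
  have "inj_on (\<lambda>x. n - x) {1..n}" by (rule inj_onI) auto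
  then obtain p where p: "p \<in> lin_ext n P" "sorted_wrt ?R p"
    by (rule P.ex_sorted_lin_ext[of "\<lambda>x. n - x" f, OF _ _ R]) auto
  have "descents p \<in> descents ` lin_ext n Q" using subsetD[OF sub imageI[OF p(1)]] .
  then obtain q where q: "q \<in> lin_ext n Q" "descents q = descents p" by (elim imageE) simp
  have pq: "distinct p" "set p = {1..n}" "length p = n" "distinct q" "set q = {1..n}" "length q = n"
    using p q lin_ext_length by (auto simp: lin_ext_def)
  define \<phi> where "\<phi> = (!) p \<circ> inv_into {..<n} ((!) q)"
  have bij: "bij_betw ((!) p) {..<n} {1..n}" "bij_betw ((!) q) {..<n} {1..n}"
    using pq by (auto intro!: bij_betw_nth)
  have \<phi>: "\<phi> (q ! i) = p ! i" if "i < n" for i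
    using bij that by (simp add: \<phi>_def bij_betw_inv_into_left)
  have "strict_map Q (f \<circ> \<phi>)"
    unfolding strict_map_def
  proof (intro allI impI, elim conjE)
    fix x y assume xy: "(x, y) \<in> Q" "x \<noteq> y"
    obtain i j where ij: "i < n" "x = q ! i" "j < n" "y = q ! j"
      using Q.in_ground[OF xy(1)] pq by (metis in_set_conv_nth)
    have "\<not> j < i"
      using q(1) ij xy pq sorted_wrt_nth_less[of "\<lambda>x y. (y, x) \<notin> Q" q j i] by (auto simp: lin_ext_def)
    then have "i < j" using ij xy by (metis linorder_neqE_nat)
    have mono: "f (p ! k) \<le> f (p ! l)" if "k \<le> l" "l < n" for k l
      using that sorted_wrt_nth_less[OF p(2), of k l] pq(3) by (cases "k = l") auto
    have "f (p ! i) \<noteq> f (p ! j)"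
    proof
      assume eq: "f (p ! i) = f (p ! j)"
      have "q ! k \<le> q ! i" if "i \<le> k" "k \<le> j" for k
        using that
      proof (induction k rule: dec_induct)
        case (step k)
        have "f (p ! k) = f (p ! Suc k)"
          using mono[of i k] mono[of k "Suc k"] mono[of "Suc k" j] step.hyps step.prems ij eq by linarith
        then have "p ! Suc k < p ! k"
          using sorted_wrt_nth_less[OF p(2), of k "Suc k"] step.prems ij pq(3) by auto
        then have "Suc k \<in> descents q"
          unfolding q(2) using step.prems ij pq(3) by (simp add: descents_def)
        then have "q ! Suc k < q ! k" by (simp add: descents_def)
        then show ?case using step by simp
      qed simp
      from this[of j] show False using Q.le[OF xy(1)] xy(2) ij \<open>i < j\<close> by simp
    qed
    then show "(f \<circ> \<phi>) x < (f \<circ> \<phi>) y"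
      using mono[of i j] \<open>i < j\<close> ij \<phi> by (simp add: le_less)
  qed
  moreover have "bij_betw \<phi> {1..n} {1..n}"
    unfolding \<phi>_def using bij by (intro bij_betw_trans[OF bij_betw_inv_into])
  ultimately show ?thesis by (rule that[rotated])
qed

section \<open>Chains and antichains\<close>

definition chain :: "nat rel \<Rightarrow> nat set \<Rightarrow> bool" where
  "chain P c \<longleftrightarrow> (\<forall>x\<in>c. \<forall>y\<in>c. (x, y) \<in> P \<or> (y, x) \<in> P)"

definition height :: "nat rel \<Rightarrow> nat set \<Rightarrow> nat" where
  "height P S = Max {card c | c. c \<subseteq> S \<and> chain P c}"

lemma height_set:
  assumes "finite S"
  shows "finite {card c | c. c \<subseteq> S \<and> chain P c}" "{card c | c. c \<subseteq> S \<and> chain P c} \<noteq> {}"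
proof -
  show "finite {card c | c. c \<subseteq> S \<and> chain P c}"
    by (rule finite_subset[of _ "card ` Pow S"]) (use assms in auto)
  have "chain P {}" by (simp add: chain_def)
  then show "{card c | c. c \<subseteq> S \<and> chain P c} \<noteq> {}" by blast
qed

lemma card_le_height: "\<lbrakk>finite S; c \<subseteq> S; chain P c\<rbrakk> \<Longrightarrow> card c \<le> height P S"
  unfolding height_def using height_set by (intro Max_ge) auto

lemma ex_chain_height:
  assumes "finite S"
  obtains c where "c \<subseteq> S" "chain P c" "card c = height P S"
proof -
  have "height P S \<in> {card c | c. c \<subseteq> S \<and> chain P c}"
    unfolding height_def by (intro Max_in height_set assms)
  then obtain c where "height P S = card c" "c \<subseteq> S" "chain P c" by blast
  then show ?thesis using that by simp
qed

lemma strict_map_inj_on_chain: "strict_map P f \<Longrightarrow> chain P c \<Longrightarrow> inj_on f c"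
  unfolding inj_on_def strict_map_def chain_def by (metis less_irrefl)

definition rank :: "nat rel \<Rightarrow> nat set \<Rightarrow> nat \<Rightarrow> nat" where
  "rank P S v = height P {u\<in>S. (u, v) \<in> P \<and> u \<noteq> v}"

lemma max_antichain_union_set:
  "finite {card (\<Union>k<i. A k) | A :: nat \<Rightarrow> nat set. \<forall>k<i. antichain n P (A k)}"
  "{card (\<Union>k<i. A k) | A :: nat \<Rightarrow> nat set. \<forall>k<i. antichain n P (A k)} \<noteq> {}"
proof -
  let ?S = "{card (\<Union>k<i. A k) | A :: nat \<Rightarrow> nat set. \<forall>k<i. antichain n P (A k)}"
  have "?S \<subseteq> card ` Pow {1..n}"
  proof
    fix x assume "x \<in> ?S"
    then obtain A :: "nat \<Rightarrow> nat set" where "x = card (\<Union>k<i. A k)" "\<forall>k<i. antichain n P (A k)" by blast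
    then show "x \<in> card ` Pow {1..n}" unfolding antichain_def by (intro image_eqI[of _ _ "\<Union>k<i. A k"]) auto
  qed
  then show "finite ?S" by (rule finite_subset) simp
  have "card (\<Union>k<i. {} :: nat set) \<in> ?S"
    by (intro CollectI exI[of _ "\<lambda>_. {}"]) (simp add: antichain_def)
  then show "?S \<noteq> {}" by auto
qed

lemma card_le_max_antichain_union:
  "(\<And>k. k < i \<Longrightarrow> antichain n P (A k)) \<Longrightarrow> card (\<Union>k<i. A k) \<le> max_antichain_union n P i"
  unfolding max_antichain_union_def using max_antichain_union_set by (intro Max_ge) auto

lemma ex_max_antichain_union:
  obtains A where "\<And>k. k < i \<Longrightarrow> antichain n P (A k)" "card (\<Union>k<i. A k) = max_antichain_union n P i"
proof -
  have "max_antichain_union n P i \<in> {card (\<Union>k<i. A k) | A :: nat \<Rightarrow> nat set. \<forall>k<i. antichain n P (A k)}"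
    unfolding max_antichain_union_def by (intro Max_in max_antichain_union_set)
  then obtain A :: "nat \<Rightarrow> nat set" where "max_antichain_union n P i = card (\<Union>k<i. A k)"
    "\<forall>k<i. antichain n P (A k)" by blast
  then show ?thesis using that[of A] by simp
qed

text \<open>Unions of \<open>k\<close> antichains as integral potentials on the network with an arc \<open>p v \<rightarrow> q v\<close> of capacity
  one for each element \<open>v\<close>: the union consists of the elements with \<open>q v = p v + 1\<close>.\<close>

definition potential :: "nat \<Rightarrow> nat rel \<Rightarrow> nat \<Rightarrow> (nat \<Rightarrow> nat) \<Rightarrow> (nat \<Rightarrow> nat) \<Rightarrow> bool" where
  "potential n P k p q \<longleftrightarrow> (\<forall>v\<in>{1..n}. p v \<le> q v \<and> q v \<le> Suc (p v) \<and> q v \<le> k) \<and>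
     (\<forall>v w. (v, w) \<in> P \<and> v \<noteq> w \<longrightarrow> q v \<le> p w)"

context nat_poset
begin

lemma rank_chain:
  assumes "S \<subseteq> {1..n}" "v \<in> {1..n}"
  obtains c where "c \<subseteq> S" "chain P c" "card c = rank P S v + of_bool (v \<in> S)" "\<forall>u\<in>c. (u, v) \<in> P"
proof -
  have fin: "finite S" using assms finite_subset by blast
  then obtain c where c: "c \<subseteq> {u\<in>S. (u, v) \<in> P \<and> u \<noteq> v}" "chain P c" "card c = rank P S v"
    unfolding rank_def using ex_chain_height[of "{u\<in>S. (u, v) \<in> P \<and> u \<noteq> v}" P] by auto
  show ?thesis
  proof (cases "v \<in> S")
    case True
    have "finite c" using finite_subset[OF c(1)] fin by simp
    moreover have "v \<notin> c" using c(1) by blast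
    moreover have "chain P (insert v c)"
      using c(1,2) refl[OF assms(2)] unfolding chain_def by blast
    moreover have "insert v c \<subseteq> S" "\<forall>u\<in>insert v c. (u, v) \<in> P"
      using c(1) True refl[OF assms(2)] by blast+
    ultimately show ?thesis using c(3) True by (intro that[of "insert v c"]) simp_all
  next
    case False
    then show ?thesis using c(2,3) c(1) by (intro that[of c]) (simp_all, blast+)
  qed
qed

lemma rank_step:
  assumes S: "S \<subseteq> {1..n}" and vw: "(v, w) \<in> P" "v \<noteq> w"
  shows "rank P S v + of_bool (v \<in> S) \<le> rank P S w"
proof -
  have "v \<in> {1..n}" using in_ground[OF vw(1)] ..
  with S obtain c where c: "c \<subseteq> S" "chain P c" "card c = rank P S v + of_bool (v \<in> S)" "\<forall>u\<in>c. (u, v) \<in> P"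
    by (rule rank_chain)
  have "(u, w) \<in> P \<and> u \<noteq> w" if "u \<in> c" for u
    using trans[OF _ vw(1)] antisym[OF vw(1)] bspec[OF c(4) that] vw(2) by blast
  then have "c \<subseteq> {u\<in>S. (u, w) \<in> P \<and> u \<noteq> w}" using c(1) by blast
  moreover have "finite {u\<in>S. (u, w) \<in> P \<and> u \<noteq> w}" using S finite_subset[of S] by simp
  ultimately show ?thesis using card_le_height[of _ c P] c(2,3) unfolding rank_def by metis
qed

lemma rank_le_height:
  assumes "S \<subseteq> {1..n}" "v \<in> {1..n}"
  shows "rank P S v + of_bool (v \<in> S) \<le> height P S"
proof -
  obtain c where "c \<subseteq> S" "chain P c" "card c = rank P S v + of_bool (v \<in> S)"
    using assms by (rule rank_chain)
  then show ?thesis using card_le_height[of S c P] finite_subset[OF assms(1)] by simp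
qed

lemma potential_rank:
  "S \<subseteq> {1..n} \<Longrightarrow> height P S \<le> k \<Longrightarrow> potential n P k (rank P S) (\<lambda>v. rank P S v + of_bool (v \<in> S))"
  unfolding potential_def
proof (intro conjI ballI allI impI)
  assume S: "S \<subseteq> {1..n}" "height P S \<le> k"
  show "rank P S v + of_bool (v \<in> S) \<le> k" if "v \<in> {1..n}" for v
    using rank_le_height[OF S(1) that] S(2) by (rule order_trans)
  show "rank P S v + of_bool (v \<in> S) \<le> rank P S w" if "(v, w) \<in> P \<and> v \<noteq> w" for v w
    using that rank_step[OF S(1)] by blast
qed simp_all

lemma strict_map_Suc_rank: "strict_map P (\<lambda>x. Suc (rank P {1..n} x))"
  unfolding strict_map_def
proof (intro allI impI, elim conjE)
  fix x y assume xy: "(x, y) \<in> P" "x \<noteq> y"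
  then show "Suc (rank P {1..n} x) < Suc (rank P {1..n} y)"
    using rank_step[OF order_refl xy] in_ground[OF xy(1)] by simp
qed

lemma Suc_rank_range: "(\<lambda>x. Suc (rank P {1..n} x)) ` {1..n} \<subseteq> {1..height P {1..n}}"
  using rank_le_height[OF order_refl] by (intro image_subsetI) simp

lemma height_Union_antichains:
  assumes A: "\<And>j. j < k \<Longrightarrow> antichain n P (A j)"
  shows "height P (\<Union>j<k. A j) \<le> k"
proof -
  have "finite (A j)" if "j < k" for j
    using A[OF that] unfolding antichain_def by (meson finite_subset finite_atLeastAtMost)
  then obtain c where c: "c \<subseteq> (\<Union>j<k. A j)" "chain P c" "card c = height P (\<Union>j<k. A j)"
    using ex_chain_height[of "\<Union>j<k. A j" P] by auto
  then have "\<forall>x\<in>c. \<exists>j<k. x \<in> A j" by blast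
  then obtain g where g: "\<forall>x\<in>c. g x < k \<and> x \<in> A (g x)" by metis
  have "inj_on g c"
  proof (rule inj_onI)
    fix x y assume xy: "x \<in> c" "y \<in> c" "g x = g y"
    then have "antichain n P (A (g x))" "x \<in> A (g x)" "y \<in> A (g x)" using g A by metis+
    moreover have "(x, y) \<in> P \<or> (y, x) \<in> P" using c(2) xy by (simp add: chain_def)
    ultimately show "x = y" unfolding antichain_def by metis
  qed
  moreover have "g ` c \<subseteq> {..<k}" using g by blast
  ultimately show ?thesis using card_inj_on_le[of g c "{..<k}"] c(3) by simp
qed

lemma potential_le_max_antichain_union:
  assumes "potential n P k p q"
  shows "(\<Sum>v\<in>{1..n}. q v - p v) \<le> max_antichain_union n P k"
proof -
  have pq: "p v \<le> q v" "q v \<le> Suc (p v)" "q v \<le> k" if "v \<in> {1..n}" for v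
    using assms that by (auto simp: potential_def)
  define A where "A j = {v\<in>{1..n}. p v = j \<and> q v = Suc j}" for j
  have "antichain n P (A j)" if "j < k" for j
    unfolding antichain_def
  proof (intro conjI ballI impI)
    fix x y assume xy: "x \<in> A j" "y \<in> A j" "(x, y) \<in> P"
    show "x = y"
    proof (rule ccontr)
      assume "x \<noteq> y"
      then have "q x \<le> p y" using assms xy by (simp add: potential_def)
      then show False using xy by (simp add: A_def)
    qed
  qed (auto simp: A_def)
  then have "card (\<Union>j<k. A j) \<le> max_antichain_union n P k" by (rule card_le_max_antichain_union)
  moreover have "(\<Union>j<k. A j) = {v\<in>{1..n}. q v = Suc (p v)}"
    using pq by (fastforce simp: A_def)
  moreover have "(\<Sum>v\<in>{1..n}. q v - p v) = (\<Sum>v\<in>{1..n}. if q v = Suc (p v) then 1 else 0)"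
    using pq by (intro sum.cong) (fastforce simp: le_Suc_eq)+
  ultimately show ?thesis by (simp add: sum.If_cases Int_def)
qed

lemma ex_potential:
  obtains p q where "potential n P k p q" "(\<Sum>v\<in>{1..n}. q v - p v) = max_antichain_union n P k"
proof -
  obtain A where A: "\<And>j. j < k \<Longrightarrow> antichain n P (A j)" "card (\<Union>j<k. A j) = max_antichain_union n P k"
    using ex_max_antichain_union by blast
  let ?S = "\<Union>j<k. A j"
  have S: "?S \<subseteq> {1..n}" using A(1) unfolding antichain_def by blast
  have "potential n P k (rank P ?S) (\<lambda>v. rank P ?S v + of_bool (v \<in> ?S))"
    using potential_rank[OF S] height_Union_antichains A(1) by blast
  moreover have "{1..n} \<inter> {v. v \<in> ?S} = ?S" using S by blast
  then have "(\<Sum>v\<in>{1..n}. of_bool (v \<in> ?S)) = card ?S" by (simp only: sum_of_bool_eq finite_atLeastAtMost of_nat_id)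
  then have "(\<Sum>v\<in>{1..n}. rank P ?S v + of_bool (v \<in> ?S) - rank P ?S v) = max_antichain_union n P k"
    using A(2) by simp
  ultimately show ?thesis by (rule that)
qed

lemma floor_ceiling_half:
  fixes e m :: nat
  assumes "e \<le> 2"
  shows "((m + e) div 2 - m div 2) + ((m + e + 1) div 2 - (m + 1) div 2) = e"
proof -
  have "m = 2 * (m div 2) \<or> m = Suc (2 * (m div 2))" by presburger
  then obtain k where "m = 2 * k \<or> m = Suc (2 * k)" by blast
  moreover have "e = 0 \<or> e = 1 \<or> e = 2" using assms by linarith
  ultimately show ?thesis by (elim disjE) simp_all
qed

text \<open>Potentials are closed under rounding their midpoint down and up, and rounding preserves the sum.\<close>

lemma max_antichain_union_concave:
  "max_antichain_union n P k + max_antichain_union n P (Suc (Suc k)) \<le> 2 * max_antichain_union n P (Suc k)"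
proof -
  obtain p q where pq: "potential n P k p q" "(\<Sum>v\<in>{1..n}. q v - p v) = max_antichain_union n P k"
    by (rule ex_potential)
  obtain r s where rs: "potential n P (Suc (Suc k)) r s"
    "(\<Sum>v\<in>{1..n}. s v - r v) = max_antichain_union n P (Suc (Suc k))"
    by (rule ex_potential)
  have b: "p v \<le> q v \<and> q v \<le> Suc (p v) \<and> q v \<le> k \<and> r v \<le> s v \<and> s v \<le> Suc (r v) \<and> s v \<le> Suc (Suc k)"
    if "v \<in> {1..n}" for v using pq(1) rs(1) that by (simp add: potential_def)
  have o: "q v \<le> p w \<and> s v \<le> r w" if "(v, w) \<in> P" "v \<noteq> w" for v w
    using pq(1) rs(1) that by (simp add: potential_def)
  let ?sum = "\<lambda>c. (\<Sum>v\<in>{1..n}. (q v + s v + c) div 2 - (p v + r v + c) div 2)"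
  have mid: "?sum c \<le> max_antichain_union n P (Suc k)" if "c \<le> 1" for c
  proof (rule potential_le_max_antichain_union)
    show "potential n P (Suc k) (\<lambda>v. (p v + r v + c) div 2) (\<lambda>v. (q v + s v + c) div 2)"
      unfolding potential_def
    proof (intro conjI ballI allI impI)
      fix v assume "v \<in> {1..n}"
      note b[OF this]
      then show "(p v + r v + c) div 2 \<le> (q v + s v + c) div 2"
        "(q v + s v + c) div 2 \<le> Suc ((p v + r v + c) div 2)" "(q v + s v + c) div 2 \<le> Suc k"
        using that by linarith+
    next
      fix v w assume "(v, w) \<in> P \<and> v \<noteq> w"
      then show "(q v + s v + c) div 2 \<le> (p w + r w + c) div 2"
        using o[of v w] by (intro div_le_mono) simp
    qed
  qed
  have "max_antichain_union n P k + max_antichain_union n P (Suc (Suc k)) =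
      (\<Sum>v\<in>{1..n}. (q v - p v) + (s v - r v))"
    by (simp only: pq(2) rs(2) sum.distrib)
  also have "\<dots> = (\<Sum>v\<in>{1..n}. ((q v + s v + 0) div 2 - (p v + r v + 0) div 2) +
      ((q v + s v + 1) div 2 - (p v + r v + 1) div 2))"
  proof (rule sum.cong)
    fix v assume "v \<in> {1..n}"
    note b[OF this]
    then obtain e where e: "(q v - p v) + (s v - r v) = e" "q v + s v = p v + r v + e" "e \<le> 2"
      by (intro that[of "(q v - p v) + (s v - r v)"]) linarith+
    show "(q v - p v) + (s v - r v) = ((q v + s v + 0) div 2 - (p v + r v + 0) div 2) +
      ((q v + s v + 1) div 2 - (p v + r v + 1) div 2)"
      unfolding e(1,2) using floor_ceiling_half[OF e(3), of "p v + r v"] by simp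
  qed simp
  also have "\<dots> = ?sum 0 + ?sum 1" by (rule sum.distrib)
  also have "\<dots> \<le> 2 * max_antichain_union n P (Suc k)" using mid[of 0] mid[of 1] by linarith
  finally show ?thesis .
qed

end
section \<open>The shape\<close>

lemma nth_antimono:
  assumes "sorted_wrt (\<ge>) (\<mu> :: nat list)" "i \<le> j" "j < length \<mu>"
  shows "\<mu> ! j \<le> \<mu> ! i"
  using sorted_wrt_nth_less[OF assms(1), of i j] assms(2,3) by (cases "i = j") simp_all

lemma le_part_iff:
  assumes \<mu>: "int_partition \<mu>" and "1 \<le> i" "1 \<le> j"
  shows "i \<le> part \<mu> j \<longleftrightarrow> j \<le> conjugate_part \<mu> i"
proof -
  let ?X = "{k \<in> {1..length \<mu>}. i \<le> part \<mu> k}"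
  have down: "k \<in> ?X" if "k \<le> l" "1 \<le> k" "l \<in> ?X" for k l
  proof -
    have "\<mu> ! (l - 1) \<le> \<mu> ! (k - 1)"
      using \<mu> that by (intro nth_antimono) (auto simp: int_partition_def)
    then show ?thesis using that by (auto simp: part_def)
  qed
  show ?thesis
  proof (cases "i \<le> part \<mu> j")
    case True
    then have "j \<in> ?X" using assms by (auto simp: part_def split: if_splits)
    then have "{1..j} \<subseteq> ?X" using down[of _ j] by (intro subsetI) simp
    then have "card {1..j} \<le> card ?X" by (intro card_mono) simp_all
    then show ?thesis using True by (simp add: conjugate_part_def)
  next
    case False
    have "?X \<subseteq> {1..<j}"
    proof
      fix k assume k: "k \<in> ?X"
      have "k < j"
      proof (rule ccontr)
        assume "\<not> k < j"
        then show False using down[OF _ assms(3) k] False by simp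
      qed
      then show "k \<in> {1..<j}" using k by simp
    qed
    then have "card ?X \<le> card {1..<j}" by (intro card_mono) simp_all
    then show ?thesis using False assms(3) by (simp add: conjugate_part_def)
  qed
qed

lemma int_partition_eqI:
  assumes \<mu>: "int_partition \<mu>" and \<nu>: "int_partition \<nu>"
    and eq: "\<And>i. 1 \<le> i \<Longrightarrow> conjugate_part \<mu> i = conjugate_part \<nu> i"
  shows "\<mu> = \<nu>"
proof -
  have part: "part \<mu> j = part \<nu> j" if "1 \<le> j" for j
  proof (rule antisym)
    show "part \<mu> j \<le> part \<nu> j"
    proof (cases "part \<mu> j = 0")
      case False
      then show ?thesis using le_part_iff[OF \<mu> _ that, of "part \<mu> j"] le_part_iff[OF \<nu> _ that, of "part \<mu> j"] eq by simp
    qed simp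
    show "part \<nu> j \<le> part \<mu> j"
    proof (cases "part \<nu> j = 0")
      case False
      then show ?thesis using le_part_iff[OF \<mu> _ that, of "part \<nu> j"] le_part_iff[OF \<nu> _ that, of "part \<nu> j"] eq by simp
    qed simp
  qed
  have len: "j \<le> length \<kappa> \<longleftrightarrow> 1 \<le> part \<kappa> j" if "int_partition \<kappa>" "1 \<le> j" for \<kappa> j
    using that by (auto simp: part_def int_partition_def)
  have "j \<le> length \<mu> \<longleftrightarrow> j \<le> length \<nu>" if "1 \<le> j" for j
    using len[OF \<mu> that] len[OF \<nu> that] part[OF that] by simp
  then have l: "length \<mu> = length \<nu>" by (metis le_antisym le_refl not_less_eq_eq One_nat_def le0)
  then show ?thesis
  proof (rule nth_equalityI)
    fix i assume "i < length \<mu>"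
    then show "\<mu> ! i = \<nu> ! i" using part[of "Suc i"] l by (simp add: part_def)
  qed
qed

lemma ex_int_partition:
  fixes b :: "nat \<Rightarrow> nat"
  assumes anti: "\<And>i j. 1 \<le> i \<Longrightarrow> i \<le> j \<Longrightarrow> b j \<le> b i" and zero: "\<And>i. n < i \<Longrightarrow> b i = 0"
  shows "\<exists>\<mu>. int_partition \<mu> \<and> (\<forall>i\<ge>1. conjugate_part \<mu> i = b i)"
proof -
  define g where "g j = card {i\<in>{1..n}. j \<le> b i}" for j
  define \<mu> where "\<mu> = map g [1..<Suc (b 1)]"
  have g: "i \<le> g j \<longleftrightarrow> j \<le> b i" if "1 \<le> i" "1 \<le> j" for i j
  proof (cases "j \<le> b i")
    case True
    then have "i \<le> n" using zero[of i] that by (metis not_le le_zero_eq not_one_le_zero)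
    have "j \<le> b k" if "k \<in> {1..i}" for k using anti[of k i] that True by simp
    then have "{1..i} \<subseteq> {i\<in>{1..n}. j \<le> b i}" using \<open>i \<le> n\<close> by auto
    then have "card {1..i} \<le> g j" unfolding g_def by (intro card_mono) simp_all
    then show ?thesis using True by simp
  next
    case False
    have "k < i" if "j \<le> b k" for k
    proof (rule ccontr)
      assume "\<not> k < i"
      then show False using anti[of i k] \<open>1 \<le> i\<close> that False by simp
    qed
    then have "{k\<in>{1..n}. j \<le> b k} \<subseteq> {1..<i}" by auto
    then have "g j \<le> card {1..<i}" unfolding g_def by (intro card_mono) simp_all
    then show ?thesis using False that by simp
  qed
  have g_anti: "g j \<le> g i" if "i \<le> j" for i j
    unfolding g_def by (intro card_mono) (use that in auto)
  have part: "part \<mu> j = g j" if "j \<in> {1..b 1}" for j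
    using that by (auto simp: part_def \<mu>_def simp del: upt_Suc)
  have "sorted_wrt (\<ge>) \<mu>"
    unfolding \<mu>_def sorted_wrt_map
    by (rule sorted_wrt_mono_rel[OF _ sorted_upt]) (rule g_anti)
  moreover have "1 \<le> a" if a: "a \<in> set \<mu>" for a
  proof -
    obtain j where "a = g j" "1 \<le> j" "j \<le> b 1" using a by (auto simp: \<mu>_def simp del: upt_Suc)
    then show ?thesis using g[of 1 j] by simp
  qed
  ultimately have "int_partition \<mu>" by (simp add: int_partition_def)
  moreover have "conjugate_part \<mu> i = b i" if "1 \<le> i" for i
  proof -
    have "length \<mu> = b 1" by (simp add: \<mu>_def)
    moreover have "i \<le> part \<mu> j \<longleftrightarrow> j \<le> b i" if "j \<in> {1..b 1}" for j
      using part[OF that] g[OF \<open>1 \<le> i\<close>, of j] that by simp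
    ultimately have "{j \<in> {1..length \<mu>}. i \<le> part \<mu> j} = {j \<in> {1..b 1}. j \<le> b i}"
      by (simp cong: conj_cong)
    also have "\<dots> = {1..b i}" using anti[OF order_refl that] by fastforce
    finally show ?thesis by (simp add: conjugate_part_def)
  qed
  ultimately show ?thesis by blast
qed

context nat_poset
begin

lemma max_antichain_union_0: "max_antichain_union n P 0 = 0"
  by (rule ex_max_antichain_union[of 0 n P]) simp

lemma max_antichain_union_mono: "max_antichain_union n P i \<le> max_antichain_union n P (Suc i)"
proof -
  obtain A where A: "\<And>k. k < i \<Longrightarrow> antichain n P (A k)" "card (\<Union>k<i. A k) = max_antichain_union n P i"
    using ex_max_antichain_union by blast
  define A' where "A' = A(i := {})"
  have "(\<Union>k<Suc i. A' k) = (\<Union>k<i. A k)" by (auto simp: A'_def lessThan_Suc)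
  moreover have "antichain n P (A' k)" if "k < Suc i" for k
    using A(1)[of k] that by (auto simp: A'_def antichain_def)
  then have "card (\<Union>k<Suc i. A' k) \<le> max_antichain_union n P (Suc i)" by (rule card_le_max_antichain_union)
  ultimately show ?thesis using A(2) by simp
qed

lemma max_antichain_union_le: "max_antichain_union n P i \<le> n"
proof -
  obtain A where A: "\<And>k. k < i \<Longrightarrow> antichain n P (A k)" "card (\<Union>k<i. A k) = max_antichain_union n P i"
    using ex_max_antichain_union by blast
  have "(\<Union>k<i. A k) \<subseteq> {1..n}" using A(1) unfolding antichain_def by blast
  then have "card (\<Union>k<i. A k) \<le> card {1..n}" by (intro card_mono) simp_all
  then show ?thesis using A(2) by simp
qed

lemma max_antichain_union_height:
  assumes "height P {1..n} \<le> k"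
  shows "max_antichain_union n P k = n"
proof (rule order_antisym[OF max_antichain_union_le])
  show "n \<le> max_antichain_union n P k"
    using potential_le_max_antichain_union[OF potential_rank[OF order_refl assms]] by simp
qed

lemma height_le: "height P {1..n} \<le> n"
proof -
  obtain c where c: "c \<subseteq> {1..n}" "card c = height P {1..n}"
    by (rule ex_chain_height[OF finite_atLeastAtMost])
  then show ?thesis using card_mono[OF _ c(1)] by simp
qed

lemma shape_props:
  "int_partition (shape n P)"
  "(\<Sum>k = 1..i. conjugate_part (shape n P) k) = max_antichain_union n P i"
proof -
  let ?a = "max_antichain_union n P"
  let ?Q = "\<lambda>\<mu>. int_partition \<mu> \<and> (\<forall>i. (\<Sum>k = 1..i. conjugate_part \<mu> k) = ?a i)"
  define b where "b i = ?a i - ?a (i - 1)" for i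
  have b_step: "b (Suc i) \<le> b i" if i: "1 \<le> i" for i
  proof -
    obtain j where "i = Suc j" using i by (cases i) auto
    then show ?thesis
      using max_antichain_union_concave[of j] max_antichain_union_mono[of j] by (simp add: b_def)
  qed
  have anti: "b j \<le> b i" if "1 \<le> i" "i \<le> j" for i j
    using that(2,1)
  proof (induction j rule: dec_induct)
    case (step k)
    then show ?case using b_step[of k] by simp
  qed simp
  have zero: "b i = 0" if "n < i" for i
    using that max_antichain_union_height[of i] max_antichain_union_height[of "i - 1"] height_le
    by (simp add: b_def)
  obtain \<mu> where \<mu>: "int_partition \<mu>" "\<forall>i\<ge>1. conjugate_part \<mu> i = b i"
    using ex_int_partition[of b n, OF anti zero] by blast
  have "(\<Sum>k = 1..i. conjugate_part \<mu> k) = ?a i" for i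
  proof (induction i)
    case (Suc i)
    then show ?case using \<mu>(2) max_antichain_union_mono[of i] by (simp add: b_def)
  qed (simp add: max_antichain_union_0)
  then have ex: "?Q \<mu>" using \<mu>(1) by blast
  have uniq: "\<nu> = \<mu>" if \<nu>: "?Q \<nu>" for \<nu>
  proof (rule int_partition_eqI)
    fix i :: nat assume "1 \<le> i"
    then obtain j where j: "i = Suc j" by (cases i) auto
    have s: "(\<Sum>k = 1..i. conjugate_part \<nu> k) = (\<Sum>k = 1..i. conjugate_part \<mu> k)"
      "(\<Sum>k = 1..j. conjugate_part \<nu> k) = (\<Sum>k = 1..j. conjugate_part \<mu> k)"
      using ex \<nu> by simp_all
    show "conjugate_part \<nu> i = conjugate_part \<mu> i" using s unfolding j by simp
  qed (use \<nu> ex in blast)+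
  have "?Q (shape n P)" unfolding shape_def by (rule theI[of ?Q, OF ex uniq])
  then show "int_partition (shape n P)" "(\<Sum>k = 1..i. conjugate_part (shape n P) k) = ?a i" by blast+
qed

lemma hook_shaped_height:
  assumes hook: "hook_shaped (shape n P)" and n: "1 \<le> n"
  shows "Suc n \<le> height P {1..n} + max_antichain_union n P 1"
proof -
  let ?a = "max_antichain_union n P"
  have "conjugate_part (shape n P) 2 \<le> 1"
    using le_part_iff[OF shape_props(1), of 2 2] hook
    by (simp add: hook_shaped_def)
  moreover have "?a 2 = ?a 1 + conjugate_part (shape n P) 2"
    unfolding shape_props(2)[symmetric] by (simp add: numeral_2_eq_2)
  ultimately have "?a 2 \<le> ?a 1 + 1" by simp
  then have step: "?a (Suc (Suc i)) \<le> ?a (Suc i) + 1" for i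
  proof (induction i)
    case 0
    then show ?case by (simp add: numeral_2_eq_2)
  next
    case (Suc i)
    then show ?case using max_antichain_union_concave[of "Suc i"] by simp
  qed
  have "?a (Suc i) \<le> ?a 1 + i" for i
  proof (induction i)
    case (Suc i)
    then show ?case using step[of i] by simp
  qed simp
  moreover obtain i where i: "height P {1..n} = Suc i"
  proof (cases "height P {1..n}")
    case 0
    then show ?thesis using max_antichain_union_height[of 0] max_antichain_union_0 n by simp
  qed (rule that)
  moreover have "?a (Suc i) = n" using max_antichain_union_height[of "Suc i"] i by simp
  ultimately show ?thesis by (metis add_Suc add.commute Suc_le_mono)
qed

end
section \<open>Hook shaped posets are interval orders\<close>

text \<open>The element \<open>x\<close> is represented by the interval from \<open>d x + 1\<close> to \<open>h - u x\<close>, and these intervals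
  are the tightest bounds for strict maps to \<open>{1..h}\<close>.\<close>

definition interval_rep :: "nat \<Rightarrow> nat rel \<Rightarrow> nat \<Rightarrow> (nat \<Rightarrow> nat) \<Rightarrow> (nat \<Rightarrow> nat) \<Rightarrow> bool" where
  "interval_rep n P h d u \<longleftrightarrow>
     (\<forall>x\<in>{1..n}. \<forall>y\<in>{1..n}. (x, y) \<in> P \<and> x \<noteq> y \<longleftrightarrow> h \<le> d y + u x) \<and>
     (\<forall>f. strict_map P f \<and> f ` {1..n} \<subseteq> {1..h} \<longrightarrow> (\<forall>x\<in>{1..n}. d x < f x \<and> f x + u x \<le> h))"

context nat_poset
begin

lemma ex_strict_map_fibre:
  assumes A: "antichain n P A"
  shows "\<exists>f. strict_map P f \<and> (\<forall>x\<in>{1..n}. f x = Suc n \<longleftrightarrow> x \<in> A)"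
proof -
  define B where "B = {x\<in>{1..n} - A. \<exists>a\<in>A. (x, a) \<in> P}"
  define f where "f x = (if x \<in> A then Suc n else if x \<in> B then x else Suc n + x)" for x
  have "f x < f y" if xy: "(x, y) \<in> P" "x \<noteq> y" for x y
  proof -
    have mem: "x \<in> {1..n}" "y \<in> {1..n}" and le: "x < y" using in_ground[OF xy(1)] le[OF xy(1)] xy(2) by auto
    have "x \<in> B" if "y \<in> A \<or> y \<in> B" "x \<notin> A"
      using that xy(1) mem trans[OF xy(1)] unfolding B_def by blast
    moreover have "x \<notin> A" if "y \<in> A" using that A xy unfolding antichain_def by blast
    moreover have "x \<notin> A" if "y \<in> B"
    proof
      assume "x \<in> A"
      obtain a where a: "a \<in> A" "(y, a) \<in> P" "y \<notin> A" using \<open>y \<in> B\<close> unfolding B_def by blast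
      then have "x = a" using trans[OF xy(1) a(2)] A \<open>x \<in> A\<close> unfolding antichain_def by blast
      then show False using antisym[OF xy(1)] a xy(2) by blast
    qed
    ultimately show ?thesis using mem le unfolding f_def by auto
  qed
  moreover have "f x = Suc n \<longleftrightarrow> x \<in> A" if "x \<in> {1..n}" for x using that by (auto simp: f_def)
  ultimately show ?thesis unfolding strict_map_def by blast
qed

lemma antichain_fibre: "strict_map P f \<Longrightarrow> antichain n P {x\<in>{1..n}. f x = k}"
  unfolding strict_map_def antichain_def by (metis (mono_tags, lifting) less_irrefl mem_Collect_eq subsetI)

lemma ex_interval_rep:
  assumes C: "C \<subseteq> {1..n}" "chain P C" "card C = h" and A: "antichain n P A" and large: "Suc n \<le> h + card A"
  shows "\<exists>d u. interval_rep n P h d u"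
proof -
  define d where "d x = card {c\<in>C. (c, x) \<in> P \<and> c \<noteq> x}" for x
  define u where "u x = card {c\<in>C. (x, c) \<in> P \<and> x \<noteq> c}" for x
  have fin: "finite C" "finite A" using C(1) A finite_subset unfolding antichain_def by blast+
  have AC: "A \<union> C \<subseteq> {1..n}" using A C(1) unfolding antichain_def by blast
  have card: "card A + card C = card (A \<union> C) + card (A \<inter> C)" using fin by (intro card_Un_Int)
  have "card (A \<union> C) \<le> n" using card_mono[OF _ AC] by simp
  then have "card (A \<inter> C) \<ge> 1" using card large C(3) by linarith
  then obtain a where a: "a \<in> A" "a \<in> C" by (metis Int_iff card.empty equals0I not_one_le_zero)
  have "A \<inter> C \<subseteq> {a}"
    using a A C(2) unfolding antichain_def chain_def by blast
  then have "card (A \<inter> C) \<le> card {a}" by (intro card_mono) simp_all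
  then have "card {1..n} \<le> card (A \<union> C)" using card large C(3) by simp
  then have cover: "A \<union> C = {1..n}" using AC by (intro card_seteq) simp_all
  have split: "d x + u x + 1 = h" if "x \<in> C" for x
  proof -
    have "C = insert x ({c\<in>C. (c, x) \<in> P \<and> c \<noteq> x} \<union> {c\<in>C. (x, c) \<in> P \<and> x \<noteq> c})"
      using that C(2) unfolding chain_def by blast
    moreover have "card (insert x ({c\<in>C. (c, x) \<in> P \<and> c \<noteq> x} \<union> {c\<in>C. (x, c) \<in> P \<and> x \<noteq> c})) =
        Suc (card ({c\<in>C. (c, x) \<in> P \<and> c \<noteq> x} \<union> {c\<in>C. (x, c) \<in> P \<and> x \<noteq> c}))"
      using fin by (intro card_insert_disjoint) auto
    moreover have "card ({c\<in>C. (c, x) \<in> P \<and> c \<noteq> x} \<union> {c\<in>C. (x, c) \<in> P \<and> x \<noteq> c}) = d x + u x"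
      unfolding d_def u_def using fin antisym by (intro card_Un_disjoint) auto
    ultimately show ?thesis using C(3) by simp
  qed
  have d_less: "d x < d y" if "(x, y) \<in> P" "x \<noteq> y" "x \<in> C" for x y
  proof -
    have "{c\<in>C. (c, x) \<in> P \<and> c \<noteq> x} \<subset> {c\<in>C. (c, y) \<in> P \<and> c \<noteq> y}"
    proof (rule psubsetI)
      show "{c\<in>C. (c, x) \<in> P \<and> c \<noteq> x} \<subseteq> {c\<in>C. (c, y) \<in> P \<and> c \<noteq> y}"
        using trans[OF _ that(1)] antisym[OF that(1)] by blast
      show "{c\<in>C. (c, x) \<in> P \<and> c \<noteq> x} \<noteq> {c\<in>C. (c, y) \<in> P \<and> c \<noteq> y}" using that by blast
    qed
    then show ?thesis unfolding d_def using fin by (intro psubset_card_mono) simp_all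
  qed
  have u_less: "u y < u x" if "(x, y) \<in> P" "x \<noteq> y" "y \<in> C" for x y
  proof -
    have "{c\<in>C. (y, c) \<in> P \<and> y \<noteq> c} \<subset> {c\<in>C. (x, c) \<in> P \<and> x \<noteq> c}"
    proof (rule psubsetI)
      show "{c\<in>C. (y, c) \<in> P \<and> y \<noteq> c} \<subseteq> {c\<in>C. (x, c) \<in> P \<and> x \<noteq> c}"
        using trans[OF that(1)] antisym[OF that(1)] by blast
      show "{c\<in>C. (y, c) \<in> P \<and> y \<noteq> c} \<noteq> {c\<in>C. (x, c) \<in> P \<and> x \<noteq> c}" using that by blast
    qed
    then show ?thesis unfolding u_def using fin by (intro psubset_card_mono) simp_all
  qed
  have d_le: "d y \<le> d x" if "\<not> ((x, y) \<in> P \<and> x \<noteq> y)" "x \<in> C" "y \<in> {1..n}" for x y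
  proof -
    have "(c, x) \<in> P \<and> c \<noteq> x" if c: "c \<in> C" "(c, y) \<in> P" "c \<noteq> y" for c
    proof -
      have "c \<noteq> x" using c \<open>\<not> ((x, y) \<in> P \<and> x \<noteq> y)\<close> by blast
      moreover have "(x, c) \<notin> P"
      proof
        assume xc: "(x, c) \<in> P"
        then have "x = y" using trans[OF xc c(2)] \<open>\<not> ((x, y) \<in> P \<and> x \<noteq> y)\<close> by blast
        then show False using antisym[OF c(2)] xc c(3) by blast
      qed
      ultimately show ?thesis using C(2) c(1) \<open>x \<in> C\<close> unfolding chain_def by blast
    qed
    then show ?thesis unfolding d_def using fin by (intro card_mono) auto
  qed
  have u_le: "u x \<le> u y" if "\<not> ((x, y) \<in> P \<and> x \<noteq> y)" "y \<in> C" "x \<in> {1..n}" for x y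
  proof -
    have "(y, c) \<in> P \<and> y \<noteq> c" if c: "c \<in> C" "(x, c) \<in> P" "x \<noteq> c" for c
    proof -
      have "c \<noteq> y" using c \<open>\<not> ((x, y) \<in> P \<and> x \<noteq> y)\<close> by blast
      moreover have "(c, y) \<notin> P"
      proof
        assume cy: "(c, y) \<in> P"
        then have "x = y" using trans[OF c(2) cy] \<open>\<not> ((x, y) \<in> P \<and> x \<noteq> y)\<close> by blast
        then show False using antisym[OF c(2)] cy c(3) by blast
      qed
      ultimately show ?thesis using C(2) c(1) \<open>y \<in> C\<close> unfolding chain_def by blast
    qed
    then show ?thesis unfolding u_def using fin by (intro card_mono) auto
  qed
  have rel: "(x, y) \<in> P \<and> x \<noteq> y \<longleftrightarrow> h \<le> d y + u x" if mem: "x \<in> {1..n}" "y \<in> {1..n}" for x y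
  proof -
    consider "x \<in> C" | "y \<in> C" | "x \<in> A" "y \<in> A" using mem cover by blast
    then show ?thesis
    proof cases
      case 1
      then show ?thesis using split[OF 1] d_less[of x y] d_le[of x y] mem
        by (cases "(x, y) \<in> P \<and> x \<noteq> y") auto
    next
      case 2
      then show ?thesis using split[OF 2] u_less[of x y] u_le[of x y] mem
        by (cases "(x, y) \<in> P \<and> x \<noteq> y") auto
    next
      case 3
      have no: "\<not> ((v, w) \<in> P \<and> v \<noteq> w)" if "v \<in> A" "w \<in> A" for v w
        using that A unfolding antichain_def by blast
      have "d y \<le> d a" using d_le[OF no[OF a(1) 3(2)] a(2) mem(2)] .
      moreover have "u x \<le> u a" using u_le[OF no[OF 3(1) a(1)] a(2) mem(1)] .
      ultimately show ?thesis using split[OF a(2)] no[OF 3] by linarith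
    qed
  qed
  have bound: "d x < f x \<and> f x + u x \<le> h"
    if f: "strict_map P f" "f ` {1..n} \<subseteq> {1..h}" and x: "x \<in> {1..n}" for f x
  proof -
    have inj: "inj_on f C" using strict_map_inj_on_chain[OF f(1) C(2)] .
    have "f ` {c\<in>C. (c, x) \<in> P \<and> c \<noteq> x} \<subseteq> {1..<f x}"
      using f C(1) unfolding strict_map_def by fastforce
    then have "d x \<le> card {1..<f x}"
      unfolding d_def using inj by (intro card_inj_on_le[of f]) (auto intro: inj_on_subset)
    moreover have "f ` {c\<in>C. (x, c) \<in> P \<and> x \<noteq> c} \<subseteq> {f x<..h}"
      using f C(1) unfolding strict_map_def by fastforce
    then have "u x \<le> card {f x<..h}"
      unfolding u_def using inj by (intro card_inj_on_le[of f]) (auto intro: inj_on_subset)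
    moreover have "f x \<in> {1..h}" using f(2) x by blast
    ultimately show ?thesis by auto
  qed
  have "interval_rep n P h d u" unfolding interval_rep_def using rel bound by blast
  then show ?thesis by blast
qed

end

text \<open>Among the strict maps to \<open>{1..h}\<close>, the least number of elements with values between \<open>i + 1\<close> and
  \<open>h - j\<close> is the number of intervals contained in that range.\<close>

lemma interval_count_le:
  assumes P: "nat_poset n P" "interval_rep n P h d u"
    and Q: "nat_poset n Q" "interval_rep n Q h d' u'"
    and sub: "descents ` lin_ext n Q \<subseteq> descents ` lin_ext n P"
  shows "card {x\<in>{1..n}. i \<le> d x \<and> j \<le> u x} \<le> card {x\<in>{1..n}. i \<le> d' x \<and> j \<le> u' x}"
proof -
  interpret Q: nat_poset n Q by fact
  have relQ: "(x, y) \<in> Q \<and> x \<noteq> y \<longleftrightarrow> h \<le> d' y + u' x" if "x \<in> {1..n}" "y \<in> {1..n}" for x y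
    using Q(2) that unfolding interval_rep_def by blast
  have less: "d' x + u' x < h" if "x \<in> {1..n}" for x
    using relQ[OF that that] by simp
  define f where "f x = (if d' x < i then Suc (d' x) else h - u' x)" for x
  have f_bounds: "d' x < f x" "f x \<le> h - u' x" if "x \<in> {1..n}" for x
    using less[OF that] by (auto simp: f_def)
  have "f x < f y" if xy: "(x, y) \<in> Q" "x \<noteq> y" for x y
  proof -
    have mem: "x \<in> {1..n}" "y \<in> {1..n}" using Q.in_ground[OF xy(1)] by auto
    have "h - u' x \<le> d' y" using relQ[OF mem] xy by auto
    then show ?thesis using f_bounds(2)[OF mem(1)] f_bounds(1)[OF mem(2)] by linarith
  qed
  then have "strict_map Q f" by (simp add: strict_map_def)
  with Q(1) P(1) sub obtain \<phi> where \<phi>: "bij_betw \<phi> {1..n} {1..n}" "strict_map P (f \<circ> \<phi>)"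
    by (rule strict_map_transfer)
  have \<phi>_in: "\<phi> x \<in> {1..n}" if "x \<in> {1..n}" for x using bij_betwE[OF \<phi>(1)] that by blast
  have "(f \<circ> \<phi>) ` {1..n} \<subseteq> {1..h}"
  proof
    fix v assume "v \<in> (f \<circ> \<phi>) ` {1..n}"
    then obtain x where "x \<in> {1..n}" "v = f (\<phi> x)" by auto
    then show "v \<in> {1..h}" using f_bounds[OF \<phi>_in[of x]] by simp
  qed
  then have "\<forall>x\<in>{1..n}. d x < (f \<circ> \<phi>) x \<and> (f \<circ> \<phi>) x + u x \<le> h"
    using P(2) \<phi>(2) unfolding interval_rep_def by blast
  then have bound: "d x < f (\<phi> x)" "f (\<phi> x) + u x \<le> h" if "x \<in> {1..n}" for x
    using that by simp_all
  have "\<phi> ` {x\<in>{1..n}. i \<le> d x \<and> j \<le> u x} \<subseteq> {x\<in>{1..n}. i \<le> d' x \<and> j \<le> u' x}"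
  proof
    fix y assume "y \<in> \<phi> ` {x\<in>{1..n}. i \<le> d x \<and> j \<le> u x}"
    then obtain x where x: "x \<in> {1..n}" "i \<le> d x" "j \<le> u x" "y = \<phi> x" by blast
    then have fy: "i < f y" "f y + j \<le> h" using bound[OF x(1)] by auto
    then have "i \<le> d' y" by (auto simp: f_def split: if_splits)
    moreover have "j \<le> u' y" using fy \<open>i \<le> d' y\<close> less[OF \<phi>_in[OF x(1)]] x(4) by (simp add: f_def)
    ultimately show "y \<in> {x\<in>{1..n}. i \<le> d' x \<and> j \<le> u' x}" using \<phi>_in x by simp
  qed
  moreover have "inj_on \<phi> {x\<in>{1..n}. i \<le> d x \<and> j \<le> u x}"
    using \<phi>(1) unfolding bij_betw_def by (auto intro: inj_on_subset)
  ultimately show ?thesis by (intro card_inj_on_le[of \<phi>]) simp_all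
qed

lemma card_eq_from_card_le:
  fixes d u d' u' :: "'a \<Rightarrow> nat"
  assumes "finite S"
    and N: "\<And>i j. card {x\<in>S. i \<le> d x \<and> j \<le> u x} = card {x\<in>S. i \<le> d' x \<and> j \<le> u' x}"
  shows "card {x\<in>S. (d x, u x) = t} = card {x\<in>S. (d' x, u' x) = t}"
proof -
  have split: "card {x\<in>S. p x \<and> i \<le> e x} = card {x\<in>S. p x \<and> e x = i} + card {x\<in>S. p x \<and> Suc i \<le> e x}"
    for p and e :: "'a \<Rightarrow> nat" and i
  proof -
    have "{x\<in>S. p x \<and> i \<le> e x} = {x\<in>S. p x \<and> e x = i} \<union> {x\<in>S. p x \<and> Suc i \<le> e x}" by auto
    then show ?thesis using assms(1) by (simp add: card_Un_disjoint disjoint_iff)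
  qed
  have "card {x\<in>S. j \<le> u x \<and> d x = i} = card {x\<in>S. j \<le> u' x \<and> d' x = i}" for i j
    using split[of "\<lambda>x. j \<le> u x" i d] split[of "\<lambda>x. j \<le> u' x" i d'] N[of i j] N[of "Suc i" j]
    by (simp add: conj_commute)
  note M = this
  have "card {x\<in>S. d x = i \<and> u x = j} = card {x\<in>S. d' x = i \<and> u' x = j}" for i j
    using split[of "\<lambda>x. d x = i" j u] split[of "\<lambda>x. d' x = i" j u'] M[of j i] M[of "Suc j" i]
    by (simp add: conj_commute)
  then show ?thesis by (cases t) simp
qed

lemma ex_bij_betw_fibres:
  assumes "finite S" and card: "\<And>t. card {x\<in>S. g x = t} = card {x\<in>S. g' x = t}"
  obtains \<phi> where "bij_betw \<phi> S S" "\<And>x. x \<in> S \<Longrightarrow> g' (\<phi> x) = g x"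
proof -
  have "\<exists>\<beta>. bij_betw \<beta> {x\<in>S. g x = t} {x\<in>S. g' x = t}" for t
    using assms by (intro finite_same_card_bij) simp_all
  then obtain \<beta> where \<beta>: "\<And>t. bij_betw (\<beta> t) {x\<in>S. g x = t} {x\<in>S. g' x = t}" by metis
  define \<phi> where "\<phi> x = \<beta> (g x) x" for x
  have \<phi>: "\<phi> x \<in> S \<and> g' (\<phi> x) = g x" if "x \<in> S" for x
    using bij_betwE[OF \<beta>[of "g x"]] that by (auto simp: \<phi>_def)
  have "inj_on \<phi> S"
  proof (rule inj_onI)
    fix x y assume xy: "x \<in> S" "y \<in> S" "\<phi> x = \<phi> y"
    then have "g x = g y" using \<phi> by metis
    then show "x = y"
      using inj_onD[OF bij_betw_imp_inj_on[OF \<beta>[of "g x"]], of x y] xy by (simp add: \<phi>_def)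
  qed
  moreover have "\<phi> ` S \<subseteq> S" using \<phi> by blast
  ultimately have "bij_betw \<phi> S S" using assms(1) by (simp add: bij_betw_def endo_inj_surj)
  then show ?thesis using \<phi> by (intro that) blast+
qed

lemma poset_isomorphic_interval_rep:
  assumes P: "nat_poset n P" "interval_rep n P h d u"
    and Q: "nat_poset n Q" "interval_rep n Q h d' u'"
    and eq: "descents ` lin_ext n P = descents ` lin_ext n Q"
  shows "poset_isomorphic n P n Q"
proof -
  interpret P: nat_poset n P by fact
  interpret Q: nat_poset n Q by fact
  have "card {x\<in>{1..n}. i \<le> d x \<and> j \<le> u x} = card {x\<in>{1..n}. i \<le> d' x \<and> j \<le> u' x}" for i j
    using interval_count_le[OF P Q] interval_count_le[OF Q P] eq by (intro order_antisym) simp_all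
  then have "card {x\<in>{1..n}. (d x, u x) = t} = card {x\<in>{1..n}. (d' x, u' x) = t}" for t
    by (intro card_eq_from_card_le) simp_all
  then obtain \<phi> where \<phi>: "bij_betw \<phi> {1..n} {1..n}"
    "\<And>x. x \<in> {1..n} \<Longrightarrow> (d' (\<phi> x), u' (\<phi> x)) = (d x, u x)"
    by (rule ex_bij_betw_fibres[rotated]) auto
  have "(x, y) \<in> P \<longleftrightarrow> (\<phi> x, \<phi> y) \<in> Q" if xy: "x \<in> {1..n}" "y \<in> {1..n}" for x y
  proof -
    have in_range: "\<phi> x \<in> {1..n}" "\<phi> y \<in> {1..n}" using bij_betwE[OF \<phi>(1)] xy by blast+
    have "(x, y) \<in> P \<and> x \<noteq> y \<longleftrightarrow> h \<le> d y + u x"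
      using P(2) xy unfolding interval_rep_def by blast
    also have "\<dots> \<longleftrightarrow> h \<le> d' (\<phi> y) + u' (\<phi> x)" using \<phi>(2) xy by simp
    also have "\<dots> \<longleftrightarrow> (\<phi> x, \<phi> y) \<in> Q \<and> \<phi> x \<noteq> \<phi> y"
      using Q(2) in_range unfolding interval_rep_def by blast
    finally have *: "(x, y) \<in> P \<and> x \<noteq> y \<longleftrightarrow> (\<phi> x, \<phi> y) \<in> Q \<and> \<phi> x \<noteq> \<phi> y" .
    show ?thesis
    proof (cases "x = y")
      case True
      then show ?thesis using P.refl Q.refl xy in_range by simp
    next
      case False
      then have "\<phi> x \<noteq> \<phi> y" using inj_on_eq_iff[OF bij_betw_imp_inj_on[OF \<phi>(1)] xy] by simp
      then show ?thesis using * False by blast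
    qed
  qed
  then show ?thesis unfolding poset_isomorphic_def using \<phi>(1) by blast
qed

lemma height_le_of_descents:
  assumes P: "nat_poset n P" and Q: "nat_poset n Q"
    and sub: "descents ` lin_ext n P \<subseteq> descents ` lin_ext n Q"
  shows "height Q {1..n} \<le> height P {1..n}"
proof -
  interpret P: nat_poset n P by fact
  obtain \<phi> where \<phi>: "bij_betw \<phi> {1..n} {1..n}" "strict_map Q ((\<lambda>x. Suc (rank P {1..n} x)) \<circ> \<phi>)"
    using P Q sub P.strict_map_Suc_rank by (rule strict_map_transfer)
  let ?g = "(\<lambda>x. Suc (rank P {1..n} x)) \<circ> \<phi>"
  obtain c where c: "c \<subseteq> {1..n}" "chain Q c" "card c = height Q {1..n}"
    by (rule ex_chain_height[OF finite_atLeastAtMost])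
  have "\<phi> ` c \<subseteq> {1..n}" using bij_betw_imp_surj_on[OF \<phi>(1)] c(1) by blast
  then have "?g ` c \<subseteq> {1..height P {1..n}}"
    unfolding image_comp[symmetric] by (rule order_trans[OF image_mono P.Suc_rank_range])
  then have "card c \<le> card {1..height P {1..n}}"
    using strict_map_inj_on_chain[OF \<phi>(2) c(2)] by (intro card_inj_on_le[of ?g]) simp_all
  then show ?thesis using c(3) by simp
qed

lemma antichain_transfer:
  assumes P: "nat_poset n P" and Q: "nat_poset n Q"
    and sub: "descents ` lin_ext n P \<subseteq> descents ` lin_ext n Q" and A: "antichain n P A"
  shows "\<exists>B. antichain n Q B \<and> card B = card A"
proof -
  interpret P: nat_poset n P by fact
  interpret Q: nat_poset n Q by fact
  obtain f where f: "strict_map P f" "\<forall>x\<in>{1..n}. f x = Suc n \<longleftrightarrow> x \<in> A"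
    using P.ex_strict_map_fibre[OF A] by blast
  obtain \<phi> where \<phi>: "bij_betw \<phi> {1..n} {1..n}" "strict_map Q (f \<circ> \<phi>)"
    using P Q sub f(1) by (rule strict_map_transfer)
  let ?B = "{x\<in>{1..n}. (f \<circ> \<phi>) x = Suc n}"
  have A_sub: "A \<subseteq> {1..n}" using A by (simp add: antichain_def)
  have "\<phi> ` ?B = A"
  proof (intro equalityI subsetI)
    fix y assume "y \<in> \<phi> ` ?B"
    then show "y \<in> A" using f(2) bij_betwE[OF \<phi>(1)] by auto
  next
    fix y assume y: "y \<in> A"
    then have "y \<in> \<phi> ` {1..n}" using A_sub bij_betw_imp_surj_on[OF \<phi>(1)] by blast
    then show "y \<in> \<phi> ` ?B" using y f(2) A_sub by fastforce
  qed
  moreover have "inj_on \<phi> ?B" using bij_betw_imp_inj_on[OF \<phi>(1)] by (rule inj_on_subset) blast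
  ultimately have "card ?B = card A" by (metis card_image)
  then show ?thesis using Q.antichain_fibre[OF \<phi>(2)] by blast
qed

lemma supp_L_eq_imp:
  assumes P: "nat_poset n P" and Q: "nat_poset m Q"
    and eq: "supp_L (P_gen_fun n P) = supp_L (P_gen_fun m Q)"
  shows "n = m" "descents ` lin_ext n P \<subseteq> descents ` lin_ext m Q"
proof -
  interpret P: nat_poset n P by fact
  interpret Q: nat_poset m Q by fact
  have *: "\<exists>\<alpha>. sum_list \<alpha> = n \<and> sum_list \<alpha> = m \<and> partial_sums \<alpha> = descents p \<and>
      partial_sums \<alpha> \<in> descents ` lin_ext m Q" if p: "p \<in> lin_ext n P" for p
  proof -
    obtain \<alpha> where \<alpha>: "composition \<alpha>" "sum_list \<alpha> = n" "partial_sums \<alpha> = descents p"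
      using ex_composition[OF descents_subset[OF p]] by blast
    then have "\<alpha> \<in> supp_L (P_gen_fun n P)" unfolding P.supp_L_P_gen_fun using p by simp
    then show ?thesis using \<alpha> unfolding eq Q.supp_L_P_gen_fun by blast
  qed
  show "descents ` lin_ext n P \<subseteq> descents ` lin_ext m Q"
  proof (rule image_subsetI)
    fix p assume "p \<in> lin_ext n P"
    from *[OF this] show "descents p \<in> descents ` lin_ext m Q" by (elim exE conjE) simp
  qed
  have "x < y \<or> x = y \<and> x < y" if "(x, y) \<in> P" "x \<noteq> y" for x y using P.le that by fastforce
  then obtain p where "p \<in> lin_ext n P"
    by (rule P.ex_sorted_lin_ext[of "\<lambda>x. x" "\<lambda>x. x", rotated 2]) simp_all
  then show "n = m" using * by blast
qed

theorem theorem4p6: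
  fixes n m :: nat and P Q :: "nat rel"
  assumes "naturally_labeled_poset n P"
    and "hook_shaped (shape n P)"
    and "naturally_labeled_poset m Q"
    and "supp_L (P_gen_fun n P) = supp_L (P_gen_fun m Q)"
  shows "poset_isomorphic n P m Q"
proof -
  have P: "nat_poset n P" and "nat_poset m Q" using assms by (simp_all add: nat_poset_def)
  interpret P: nat_poset n P by fact
  have mn: "m = n" using supp_L_eq_imp(1)[OF P \<open>nat_poset m Q\<close> assms(4)] by simp
  have Q: "nat_poset n Q" using \<open>nat_poset m Q\<close> mn by simp
  interpret Q: nat_poset n Q by fact
  have eq: "supp_L (P_gen_fun n P) = supp_L (P_gen_fun n Q)" using assms(4) mn by simp
  have sub: "descents ` lin_ext n P \<subseteq> descents ` lin_ext n Q"
    "descents ` lin_ext n Q \<subseteq> descents ` lin_ext n P"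
    using supp_L_eq_imp(2)[OF P Q eq] supp_L_eq_imp(2)[OF Q P eq[symmetric]] .
  show ?thesis
  proof (cases "n = 0")
    case True
    then show ?thesis by (auto simp: mn poset_isomorphic_def bij_betw_def)
  next
    case False
    define h where "h = height P {1..n}"
    have hQ: "height Q {1..n} = h"
      unfolding h_def using height_le_of_descents[OF P Q sub(1)] height_le_of_descents[OF Q P sub(2)]
      by (rule order_antisym)
    obtain A' :: "nat \<Rightarrow> nat set" where A': "\<And>k. k < 1 \<Longrightarrow> antichain n P (A' k)"
      "card (\<Union>k<1. A' k) = max_antichain_union n P 1"
      using ex_max_antichain_union by blast
    define A where "A = A' 0"
    have A: "antichain n P A" using A'(1)[of 0] by (simp add: A_def)
    have "card A = max_antichain_union n P 1" using A'(2) by (simp add: A_def lessThan_Suc)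
    then have large: "Suc n \<le> h + card A"
      using P.hook_shaped_height[OF assms(2)] False by (simp add: h_def)
    obtain C where C: "C \<subseteq> {1..n}" "chain P C" "card C = h"
      unfolding h_def by (rule ex_chain_height[OF finite_atLeastAtMost])
    obtain d u where du: "interval_rep n P h d u" using P.ex_interval_rep[OF C A large] by blast
    obtain B where B: "antichain n Q B" "card B = card A" using antichain_transfer[OF P Q sub(1) A] by blast
    obtain C' where C': "C' \<subseteq> {1..n}" "chain Q C'" "card C' = h"
      unfolding hQ[symmetric] by (rule ex_chain_height[OF finite_atLeastAtMost])
    obtain d' u' where du': "interval_rep n Q h d' u'" using Q.ex_interval_rep[OF C' B(1)] large B(2) by auto
    have "descents ` lin_ext n P = descents ` lin_ext n Q" using sub by (rule equalityI)
    then show ?thesis unfolding mn by (rule poset_isomorphic_interval_rep[OF P du Q du'])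
  qed
qed

end
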